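(* Let $\{\xi_k\}_{k=0}^\infty$ be a sequence of independent identically distributed real- or complex-valued random variables with $\mathbf{P}(\xi_0=0)<1$, and let $G_n(z)=\xi_0+\xi_1z+\dots+\xi_nz^n$. Suppose that $\mathbf{E}\log(1+|\xi_0|)<\infty$. Then, almost surely, the empirical distribution $N_n/n$ of the zeros of $G_n$ converges weakly, as $n\to\infty$, to the probability measure $N(\cdot)=\mu(\cdot\cap\Gamma)/(2\pi)$ on $\mathbb{C}$, where $\Gamma=\{z\in\mathbb{C}:|z|=1\}$ and $\mu$ is the Lebesgue (arc length) measure on $\Gamma$.
   Context: For a measurable set $A\subset\mathbb{C}$, $N_n(A)$ denotes the number of zeros of $G_n$ lying in $A$, counted with multiplicity. On the event that $G_n$ is identically zero (which a.s. occurs for only finitely many $n$) put $N_n=0$. *)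

theory Defs
  imports
    "HOL-Probability.Probability"
    "HOL-Computational_Algebra.Polynomial"
begin

definition coeff_poly :: "(nat \<Rightarrow> complex) \<Rightarrow> nat \<Rightarrow> complex poly"
  where "coeff_poly a n = (\<Sum>k\<le>n. monom (a k) k)"

lemma poly_coeff_poly: "poly (coeff_poly a n) z = (\<Sum>k\<le>n. a k * z ^ k)"
  by (simp add: coeff_poly_def poly_sum poly_monom)

(* proots lists every root as often as its order. As proots 0 is empty, the zero polynomial
   counts as having no zeros. *)
definition zero_count :: "complex poly \<Rightarrow> complex set \<Rightarrow> nat"
  where "zero_count p A = size (filter_mset (\<lambda>z. z \<in> A) (proots p))"

lemma zero_count_0 [simp]: "zero_count 0 A = 0"
  by (simp add: zero_count_def)

lemma zero_count_eq_sum_order: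
  assumes "p \<noteq> 0"
  shows "zero_count p A = (\<Sum>z \<in> {z \<in> A. poly p z = 0}. order z p)"
proof -
  have *: "{z. poly p z = 0 \<and> z \<in> A} = {z \<in> A. poly p z = 0}"
    by auto
  show ?thesis
    using assms unfolding zero_count_def size_multiset_overloaded_eq
    by (auto simp: * intro!: sum.cong)
qed

definition zero_measure :: "complex poly \<Rightarrow> complex measure"
  where "zero_measure p = measure_of UNIV (sets borel) (\<lambda>A. of_nat (zero_count p A))"

lemma space_zero_measure [simp]: "space (zero_measure p) = UNIV"
  by (simp add: zero_measure_def space_measure_of_conv)

lemma sets_zero_measure [simp, measurable_cong]: "sets (zero_measure p) = sets borel"
  unfolding zero_measure_def
  by (metis sets.sets_measure_of_eq space_borel)

lemma of_nat_zero_count: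
  "(of_nat (zero_count p A) :: ennreal)
     = (\<Sum>z\<in>set_mset (proots p). of_nat (count (proots p) z) * indicator A z)"
proof -
  have "zero_count p A = (\<Sum>z\<in>set_mset (proots p). count (proots p) z * indicator A z)"
    unfolding zero_count_def size_multiset_overloaded_eq
    by (intro sum.mono_neutral_cong_left) (auto simp: indicator_def)
  then show ?thesis
    by (auto simp: indicator_def intro!: sum.cong)
qed

lemma emeasure_zero_measure:
  assumes "A \<in> sets borel"
  shows "emeasure (zero_measure p) A = of_nat (zero_count p A)"
  unfolding zero_measure_def
proof (rule emeasure_measure_of_sigma)
  show "sigma_algebra UNIV (sets (borel :: complex measure))"
    using sets.sigma_algebra_axioms[of "borel :: complex measure"] by simp
  show "positive (sets borel) (\<lambda>A. of_nat (zero_count p A) :: ennreal)"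
    by (simp add: positive_def zero_count_def)
  show "countably_additive (sets borel) (\<lambda>A. of_nat (zero_count p A) :: ennreal)"
  proof (rule countably_additiveI)
    fix B :: "nat \<Rightarrow> complex set"
    assume "disjoint_family B"
    then show "(\<Sum>i. of_nat (zero_count p (B i)) :: ennreal) = of_nat (zero_count p (\<Union>i. B i))"
      by (simp add: of_nat_zero_count suminf_sum suminf_indicator
          del: sum_mult_indicator Indicator_Function.sum_mult_indicator)
  qed
qed fact

definition empirical_zero_measure :: "nat \<Rightarrow> complex poly \<Rightarrow> complex measure"
  where "empirical_zero_measure n p = scale_measure (ennreal (1 / real n)) (zero_measure p)"

lemma measure_empirical_zero_measure:
  assumes "A \<in> sets borel"
  shows "measure (empirical_zero_measure n p) A = real (zero_count p A) / real n"
  unfolding empirical_zero_measure_def measure_def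
  using assms by (simp add: emeasure_zero_measure enn2real_mult)

lemma space_empirical_zero_measure [simp]: "space (empirical_zero_measure n p) = UNIV"
  by (simp add: empirical_zero_measure_def space_scale_measure)

lemma sets_empirical_zero_measure [simp, measurable_cong]:
  "sets (empirical_zero_measure n p) = sets borel"
  by (simp add: empirical_zero_measure_def)

lemma finite_measure_empirical_zero_measure: "finite_measure (empirical_zero_measure n p)"
proof
  show "emeasure (empirical_zero_measure n p) (space (empirical_zero_measure n p)) \<noteq> \<infinity>"
    by (simp add: empirical_zero_measure_def space_scale_measure emeasure_zero_measure
        ennreal_mult_eq_top_iff)
qed

(* The map cis is the unit speed parametrization of the circle, so pushing Lebesgue measure on
   [0, 2 pi) forward along it yields arc length. *)
definition circle_arc_length :: "complex measure"
  where "circle_arc_length =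
    distr (restrict_space lborel {0..<2 * pi}) (restrict_space borel (sphere 0 1)) cis"

definition uniform_circle :: "complex measure"
  where "uniform_circle = measure_of UNIV (sets borel)
    (\<lambda>A. emeasure circle_arc_length (A \<inter> sphere 0 1) / ennreal (2 * pi))"

lemma borel_measurable_cis [measurable]: "cis \<in> borel_measurable borel"
  by (intro borel_measurable_continuous_onI continuous_intros)

lemma cis_measurable_circle:
  "cis \<in> measurable (restrict_space lborel {0..<2 * pi}) (restrict_space borel (sphere 0 1))"
  by (intro measurable_restrict_space2 measurable_restrict_space1) auto

lemma emeasure_circle_arc_length:
  assumes "A \<in> sets borel"
  shows "emeasure circle_arc_length (A \<inter> sphere 0 1)
    = emeasure lborel {t \<in> {0..<2 * pi}. cis t \<in> A}"
proof -
  have "A \<inter> sphere 0 1 \<in> sets (restrict_space borel (sphere 0 1))"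
    using assms by (auto simp: sets_restrict_space)
  then have "emeasure circle_arc_length (A \<inter> sphere 0 1)
    = emeasure (restrict_space lborel {0..<2 * pi})
        (cis -` (A \<inter> sphere 0 1) \<inter> space (restrict_space lborel {0..<2 * pi}))"
    unfolding circle_arc_length_def using cis_measurable_circle by (rule emeasure_distr[rotated])
  also have "cis -` (A \<inter> sphere 0 1) \<inter> space (restrict_space lborel {0..<2 * pi})
    = {t \<in> {0..<2 * pi}. cis t \<in> A}"
    by (auto simp: space_restrict_space)
  also have "emeasure (restrict_space lborel {0..<2 * pi}) {t \<in> {0..<2 * pi}. cis t \<in> A}
    = emeasure lborel {t \<in> {0..<2 * pi}. cis t \<in> A}"
    by (rule emeasure_restrict_space) auto
  finally show ?thesis .
qed

lemma emeasure_distr_cis: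
  assumes "A \<in> sets borel"
  shows "emeasure (distr (restrict_space lborel {0..<2 * pi}) borel cis) A
    = emeasure circle_arc_length (A \<inter> sphere 0 1)"
proof -
  have cis: "cis \<in> measurable (restrict_space lborel {0..<2 * pi}) borel"
    by (intro measurable_restrict_space1) auto
  have "emeasure (distr (restrict_space lborel {0..<2 * pi}) borel cis) A
    = emeasure (restrict_space lborel {0..<2 * pi}) {t \<in> {0..<2 * pi}. cis t \<in> A}"
    using assms cis
    by (subst emeasure_distr) (auto simp: space_restrict_space intro!: arg_cong2[where f=emeasure])
  also have "\<dots> = emeasure lborel {t \<in> {0..<2 * pi}. cis t \<in> A}"
    by (rule emeasure_restrict_space) auto
  finally show ?thesis
    using assms by (simp add: emeasure_circle_arc_length)
qed

lemma uniform_circle_eq_distr: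
  "uniform_circle =
    scale_measure (1 / ennreal (2 * pi)) (distr (restrict_space lborel {0..<2 * pi}) borel cis)"
  (is "_ = ?M")
proof -
  have eq: "emeasure circle_arc_length (A \<inter> sphere 0 1) / ennreal (2 * pi) = emeasure ?M A"
    if "A \<in> sets borel" for A
    using that by (simp add: emeasure_distr_cis ennreal_divide_times)
  have space: "space ?M = UNIV"
    by (simp add: space_scale_measure)
  have "uniform_circle = measure_of UNIV (sets borel) (emeasure ?M)"
    unfolding uniform_circle_def
    by (rule measure_of_eq) (use eq in \<open>auto simp: sets.sigma_sets_eq[of borel, simplified]\<close>)
  also have "\<dots> = measure_of (space ?M) (sets ?M) (emeasure ?M)"
    by (simp only: space sets_scale_measure sets_distr)
  finally show ?thesis
    by (simp only: measure_of_of_measure)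
qed

lemma space_uniform_circle [simp]: "space uniform_circle = UNIV"
  by (simp add: uniform_circle_eq_distr space_scale_measure)

lemma sets_uniform_circle [simp, measurable_cong]: "sets uniform_circle = sets borel"
  by (simp add: uniform_circle_eq_distr)

lemma emeasure_uniform_circle:
  assumes "A \<in> sets borel"
  shows "emeasure uniform_circle A
    = emeasure circle_arc_length (A \<inter> sphere 0 1) / ennreal (2 * pi)"
  using assms by (simp add: uniform_circle_eq_distr emeasure_distr_cis ennreal_divide_times)

lemma prob_space_uniform_circle: "prob_space uniform_circle"
proof
  have "{t. 0 \<le> t \<and> t < 2 * pi} = {0..<2 * pi}"
    by auto
  then have "emeasure circle_arc_length (UNIV \<inter> sphere 0 1) = ennreal (2 * pi)"
    using emeasure_circle_arc_length[of UNIV] by simp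
  then show "emeasure uniform_circle (space uniform_circle) = 1"
    by (simp add: emeasure_uniform_circle ennreal_divide_self)
qed

(* Weak convergence of finite Borel measures; the library's weak_conv_m is confined to the real
   line. Empirical zero measures may have mass below 1, as the leading coefficient can vanish,
   so the M_seq n need not be probability measures. *)
definition weakly_converges :: "(nat \<Rightarrow> 'a::topological_space measure) \<Rightarrow> 'a measure \<Rightarrow> bool"
  where "weakly_converges M_seq M \<longleftrightarrow>
    (\<forall>n. finite_measure (M_seq n) \<and> sets (M_seq n) = sets borel) \<and>
    finite_measure M \<and> sets M = sets borel \<and>
    (\<forall>f :: 'a \<Rightarrow> real. continuous_on UNIV f \<longrightarrow> bounded (range f) \<longrightarrow>
      (\<lambda>n. integral\<^sup>L (M_seq n) f) \<longlonglongrightarrow> integral\<^sup>L M f)"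

end

(* By the moment condition and Borel-Cantelli, almost surely the coefficients grow subexponentially,
   and by independence, for each eps > 0, there is for all large n an index m in [(1 - eps) n, n]
   with |xi_m| >= delta, where P(|xi_0| >= delta) > 0. The rest is deterministic. Landau's inequality
   bounds the Mahler measure of G_n by its 2-norm, so it is subexponential; comparing it with the
   lowest nonzero coefficient and with the coefficient of index m shows that only o(n) zeros lie
   outside any given annulus around the unit circle, and that deg G_n / n tends to 1. If a_0 is not
   zero, the power sums of the inverse zeros of G_n are determined by the low order coefficients
   (logarithmic derivative), hence bounded in n. Dividing by n, all nontrivial Fourier coefficients of
   the distribution of the arguments tend to 0, which is Weyl's criterion for equidistribution. *)

theory Submission
  imports Defs "HOL-Computational_Algebra.Computational_Algebra" "HOL-Real_Asymp.Real_Asymp"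
begin

text \<open>Inverse powers are used because the sum of the inverse (k+1)-st powers of the zeros
  depends only on the coefficients of index at most k+1, which stay the same once n exceeds k. Sums
  of positive powers would depend on the top coefficients, which change with n. The price is that
  inverse powers blow up at 0, so a lower bound for the moduli of all zeros, uniform in n, is
  required before a few zeros off the circle can be neglected. This yields the Fourier coefficients
  of one sign only; conjugation on the circle gives the others.

  The inside and the outside of the circle are not symmetric. The lowest nonzero coefficient is
  fixed, so it controls the inside directly. The leading coefficient may vanish or be extremely
  small for infinitely many n, because the moment condition restricts large values only. Hence the
  outside is controlled by a coefficient of index m merely close to n. Its estimate has a free
  parameter \<open>y\<close>: a large \<open>y\<close> makes \<open>(1 + 1 / y) ^ degree p\<close>
  cheap, and \<open>y ^ (degree p - m)\<close> is then cheap because m is close to n.\<close>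

lemma prod_mset_if_const:
  "(\<Prod>z\<in>#A. if P z then c else 1) = (c :: 'b :: comm_monoid_mult) ^ size (filter_mset P A)"
  by (induction A) auto

lemma norm_prod_mset:
  "norm (\<Prod>z\<in>#A. f z :: 'b :: {real_normed_field}) = (\<Prod>z\<in>#A. norm (f z))"
  by (induction A) (auto simp: norm_mult)

lemma prod_mset_nonneg_mono:
  fixes f g :: "'a \<Rightarrow> real"
  assumes "\<And>z. z \<in># A \<Longrightarrow> 0 \<le> f z" "\<And>z. z \<in># A \<Longrightarrow> f z \<le> g z"
  shows "0 \<le> (\<Prod>z\<in>#A. f z) \<and> (\<Prod>z\<in>#A. f z) \<le> (\<Prod>z\<in>#A. g z)"
  using assms
proof (induction A)
  case (add z A)
  then show ?case
    by (auto intro!: mult_mono mult_nonneg_nonneg intro: order_trans)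
qed auto

section \<open>Landau's inequality\<close>

definition coeff_sq_sum :: "complex poly \<Rightarrow> real"
  where "coeff_sq_sum p = (\<Sum>i\<le>degree p. (norm (coeff p i))\<^sup>2)"

lemma coeff_sq_sum_eq:
  assumes "degree p \<le> n"
  shows "coeff_sq_sum p = (\<Sum>i\<le>n. (norm (coeff p i))\<^sup>2)"
  unfolding coeff_sq_sum_def using assms
  by (intro sum.mono_neutral_left) (auto simp: coeff_eq_0)

lemma coeff_le_coeff_sq_sum: "(norm (coeff p k))\<^sup>2 \<le> coeff_sq_sum p"
proof -
  have "coeff_sq_sum p = (\<Sum>i\<le>max k (degree p). (norm (coeff p i))\<^sup>2)"
    by (rule coeff_sq_sum_eq) simp
  then show ?thesis
    using member_le_sum[of k "{..max k (degree p)}" "\<lambda>i. (norm (coeff p i))\<^sup>2"] by simp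
qed

text \<open>On the unit circle \<open>w - z\<close> and \<open>1 - cnj z * w\<close> have the same
  modulus, so Parseval's identity predicts the equality. The proof is algebraic: the cross terms of
  the squared coefficients agree, and what remains telescopes.\<close>

lemma coeff_sq_sum_reflect_root:
  "coeff_sq_sum ([:-z, 1:] * q) = coeff_sq_sum ([:1, -cnj z:] * q)"
proof -
  \<comment> \<open>One index beyond the degree of \<open>q\<close>, so that the upper end of the
    telescoping sum is 0.\<close>
  define N where "N = Suc (degree q)"
  have deg: "degree ([:c, d:] * q) \<le> N" for c d
    using degree_mult_le[of "[:c, d:]" q] degree_pCons_le[of c "[:d:]"] by (simp add: N_def)
  have step: "(norm (coeff ([:-z, 1:] * q) (Suc j)))\<^sup>2 - (norm (coeff ([:1, -cnj z:] * q) (Suc j)))\<^sup>2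
     = ((norm z)\<^sup>2 - 1) * ((norm (coeff q (Suc j)))\<^sup>2 - (norm (coeff q j))\<^sup>2)" for j
    unfolding cmod_power2 by (simp add: power2_eq_square algebra_simps)
  have tele: "(\<Sum>j<N. ((norm z)\<^sup>2 - 1) * ((norm (coeff q (Suc j)))\<^sup>2 - (norm (coeff q j))\<^sup>2))
     = ((norm z)\<^sup>2 - 1) * ((norm (coeff q N))\<^sup>2 - (norm (coeff q 0))\<^sup>2)"
    by (simp add: sum_distrib_left[symmetric] sum_lessThan_telescope[of "\<lambda>j. (norm (coeff q j))\<^sup>2"])
  have "coeff_sq_sum ([:-z, 1:] * q) - coeff_sq_sum ([:1, -cnj z:] * q)
     = ((norm z)\<^sup>2 - 1) * (norm (coeff q 0))\<^sup>2
       + (\<Sum>j<N. (norm (coeff ([:-z, 1:] * q) (Suc j)))\<^sup>2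
                - (norm (coeff ([:1, -cnj z:] * q) (Suc j)))\<^sup>2)"
    unfolding coeff_sq_sum_eq[OF deg] sum_subtractf[symmetric]
    by (subst sum.atMost_shift) (simp add: norm_mult power_mult_distrib algebra_simps)
  also have "\<dots> = ((norm z)\<^sup>2 - 1) * (norm (coeff q N))\<^sup>2"
    unfolding step tele by (simp add: algebra_simps)
  also have "\<dots> = 0"
    by (simp add: N_def coeff_eq_0)
  finally show ?thesis by simp
qed

text \<open>Replacing the factors \<open>X - z\<close> with \<open>\<bar>z\<bar> > 1\<close> by \<open>1 - cnj z X\<close> keeps the 2-norm and turns the
  leading coefficient into the product of these roots.\<close>
lemma landau_inequality_mult:
  assumes "degree q \<le> k"
  shows "((\<Prod>z\<in>#A. max 1 (norm z)) * norm (coeff q k))\<^sup>2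
           \<le> coeff_sq_sum ((\<Prod>z\<in>#A. [:-z, 1:]) * q)"
  using assms
proof (induction A arbitrary: q k)
  case empty
  then show ?case by (simp add: coeff_le_coeff_sq_sum)
next
  case (add z A)
  let ?P = "\<Prod>z\<in>#A. [:-z, 1:]"
  have deg: "degree ([:c, d:] * q) \<le> Suc k" for c d
    using degree_mult_le[of "[:c, d:]" q] degree_pCons_le[of c "[:d:]"] add.prems by simp
  \<comment> \<open>Hence the coefficient of index \<open>Suc k\<close> is \<open>coeff q k\<close>
    after multiplication by \<open>[:-z, 1:]\<close>, and \<open>- cnj z * coeff q k\<close> after
    multiplication by \<open>[:1, -cnj z:]\<close>. This is why the induction tracks a degree bound
    \<open>k\<close> for an arbitrary \<open>q\<close>.\<close>
  have 0: "coeff q (Suc k) = 0"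
    using add.prems by (simp add: coeff_eq_0)
  show ?case
  proof (cases "norm z \<le> 1")
    case True
    have "((\<Prod>z\<in>#A. max 1 (norm z)) * norm (coeff ([:-z, 1:] * q) (Suc k)))\<^sup>2
           \<le> coeff_sq_sum (?P * ([:-z, 1:] * q))"
      by (rule add.IH[OF deg])
    also have "?P * ([:-z, 1:] * q) = (\<Prod>z\<in>#add_mset z A. [:-z, 1:]) * q"
      by (simp only: image_mset_add_mset prod_mset.add_mset ac_simps)
    finally show ?thesis
      using True 0 by simp
  next
    case False
    have "((\<Prod>z\<in>#A. max 1 (norm z)) * norm (coeff ([:1, -cnj z:] * q) (Suc k)))\<^sup>2
           \<le> coeff_sq_sum (?P * ([:1, -cnj z:] * q))"
      by (rule add.IH[OF deg])
    also have "?P * ([:1, -cnj z:] * q) = [:1, -cnj z:] * (?P * q)"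
      by (simp only: ac_simps)
    also have "coeff_sq_sum \<dots> = coeff_sq_sum ([:-z, 1:] * (?P * q))"
      by (rule coeff_sq_sum_reflect_root[symmetric])
    also have "[:-z, 1:] * (?P * q) = (\<Prod>z\<in>#add_mset z A. [:-z, 1:]) * q"
      by (simp only: image_mset_add_mset prod_mset.add_mset ac_simps)
    finally show ?thesis
      using False 0 by (simp add: norm_mult max_def ac_simps)
  qed
qed

text \<open>By Jensen's formula this is the exponential of the mean of
  \<open>ln (norm (poly p z))\<close> over the unit circle (for nonzero \<open>p\<close>). The
  product form allows comparison root by root.\<close>

definition mahler :: "complex poly \<Rightarrow> real"
  where "mahler p = norm (lead_coeff p) * (\<Prod>z\<in>#proots p. max 1 (norm z))"

lemma poly_eq_proots:
  fixes p :: "complex poly"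
  shows "p = (\<Prod>z\<in>#proots p. [:-z, 1:]) * [:lead_coeff p:]"
  using complex_poly_decompose_multiset[of p] by simp

lemma landau_inequality: "(mahler p)\<^sup>2 \<le> coeff_sq_sum p"
  using landau_inequality_mult[of "[:lead_coeff p:]" 0 "proots p"]
  unfolding poly_eq_proots[of p, symmetric] mahler_def by (simp add: ac_simps)

section \<open>Counting zeros off the circle by means of the Mahler measure\<close>

text \<open>Up to sign the coefficients are elementary symmetric functions of the roots, so they are
  dominated by those of the product of the \<open>X + norm z\<close>. The latter are nonnegative,
  and each single term is at most the value at \<open>y\<close>.\<close>

lemma coeff_prod_linear_le:
  fixes y :: real
  assumes "y > 0"
  shows "norm (coeff (\<Prod>z\<in>#A. [:-z, 1:] :: complex poly) m) * y ^ m \<le> (\<Prod>z\<in>#A. y + norm z)"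
proof (induction A arbitrary: m)
  case empty
  show ?case by (cases m) auto
next
  case (add z A)
  let ?P = "\<Prod>z\<in>#A. [:-z, 1:]"
  show ?case
  proof (cases m)
    case 0
    have "norm z * norm (coeff ?P 0) \<le> norm z * (\<Prod>z\<in>#A. y + norm z)"
      using add.IH[of 0] by (intro mult_left_mono) auto
    moreover have "0 \<le> y * (\<Prod>z\<in>#A. y + norm z)"
      using assms order_trans[OF norm_ge_zero add.IH[of 0, simplified]] by simp
    ultimately show ?thesis
      using 0 by (simp add: norm_mult algebra_simps)
  next
    case (Suc k)
    have "norm (coeff ([:-z, 1:] * ?P) (Suc k)) * y ^ Suc k
       \<le> (norm z * norm (coeff ?P (Suc k)) + norm (coeff ?P k)) * y ^ Suc k"
      using assms norm_triangle_ineq[of "- z * coeff ?P (Suc k)" "coeff ?P k"]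
      by (intro mult_right_mono) (auto simp: norm_mult)
    also have "\<dots> = norm z * (norm (coeff ?P (Suc k)) * y ^ Suc k) + y * (norm (coeff ?P k) * y ^ k)"
      by (simp add: algebra_simps)
    also have "\<dots> \<le> norm z * (\<Prod>z\<in>#A. y + norm z) + y * (\<Prod>z\<in>#A. y + norm z)"
      using assms by (intro add_mono mult_left_mono add.IH) auto
    finally show ?thesis
      using Suc by (simp add: algebra_simps)
  qed
qed

text \<open>A zero with \<open>\<bar>z\<bar> > R\<close> contributes to \<open>coeff p m\<close>, for \<open>m\<close> close to the degree, noticeably
  less than it contributes to the Mahler measure. The gain per zero, in terms of \<open>y\<close>, is
  \<open>(1 + 1 / y) / (1 / R + 1 / y)\<close>; its least value for \<open>y \<ge> 1\<close> is \<open>2 R / (R + 1)\<close>.\<close>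
lemma size_large_roots_le:
  fixes R y :: real
  assumes R: "R > 1" and y: "y \<ge> 1" and m: "m \<le> degree p"
  shows "norm (coeff p m) * (2 * R / (R + 1)) ^ size {#z \<in># proots p. norm z > R#}
    \<le> y ^ (degree p - m) * (1 + 1 / y) ^ degree p * mahler p"
proof (cases "p = 0")
  case False
  define \<rho> where "\<rho> = 2 * R / (R + 1)"
  have \<rho>: "\<rho> > 0" using R by (simp add: \<rho>_def)
  let ?A = "proots p"
  let ?K = "size {#z \<in># ?A. norm z > R#}"
  have dsize: "size ?A = degree p" by (rule size_proots_complex)
  have factor: "(y + norm z) * (if norm z > R then \<rho> else 1) \<le> (y + 1) * max 1 (norm z)" for z :: complex
  proof (cases "norm z > R")
    case True
    have "(y + norm z) * (2 * R) \<le> (y + 1) * norm z * (R + 1)"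
    proof -
      \<comment> \<open>The difference is affine in \<open>norm z\<close>, and it is expanded here
        at \<open>norm z = R\<close>: slope \<open>y * (R + 1) - (R - 1)\<close>, value
        \<open>(R - 1) * R * (y - 1)\<close>.\<close>
      have "(y + 1) * norm z * (R + 1) - (y + norm z) * (2 * R)
         = (norm z - R) * (y * (R + 1) - (R - 1)) + (R - 1) * R * (y - 1)"
        by (simp add: algebra_simps)
      also have "\<dots> \<ge> 0"
      proof -
        have "1 * (R + 1) \<le> y * (R + 1)" using R y by (intro mult_right_mono) auto
        then have "0 \<le> y * (R + 1) - (R - 1)" by simp
        then show ?thesis using True R y by (intro add_nonneg_nonneg mult_nonneg_nonneg) auto
      qed
      finally show ?thesis by simp
    qed
    then show ?thesis
      using True R by (simp add: \<rho>_def field_simps)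
  next
    case False
    have "y + norm z \<le> (y + 1) * max 1 (norm z)"
      using y mult_left_mono[of 1 "max 1 (norm z)" y] by (auto simp: algebra_simps max_def)
    then show ?thesis using False by simp
  qed
  have "norm (coeff p m) = norm (lead_coeff p) * norm (coeff (\<Prod>z\<in>#?A. [:-z, 1:]) m)"
    by (subst (1) poly_eq_proots) (simp add: norm_mult)
  then have "norm (coeff p m) * y ^ m * \<rho> ^ ?K
     = norm (lead_coeff p) * (norm (coeff (\<Prod>z\<in>#?A. [:-z, 1:]) m) * y ^ m) * \<rho> ^ ?K"
    by simp
  also have "\<dots> \<le> norm (lead_coeff p) * (\<Prod>z\<in>#?A. y + norm z) * \<rho> ^ ?K"
    using y \<rho> by (intro mult_right_mono mult_left_mono coeff_prod_linear_le) auto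
  also have "\<dots> = norm (lead_coeff p) * (\<Prod>z\<in>#?A. (y + norm z) * (if norm z > R then \<rho> else 1))"
    by (simp add: prod_mset_if_const prod_mset.distrib)
  also have "\<dots> \<le> norm (lead_coeff p) * (\<Prod>z\<in>#?A. (y + 1) * max 1 (norm z))"
    using y \<rho> factor
    by (intro mult_left_mono conjunct2[OF prod_mset_nonneg_mono] mult_nonneg_nonneg) auto
  also have "\<dots> = (y + 1) ^ degree p * mahler p"
    by (simp add: mahler_def prod_mset.distrib dsize)
  finally have "norm (coeff p m) * y ^ m * \<rho> ^ ?K \<le> (y + 1) ^ degree p * mahler p" .
  moreover have "(y + 1) ^ degree p = y ^ m * (y ^ (degree p - m) * (1 + 1 / y) ^ degree p)"
  proof -
    have "y + 1 = y * (1 + 1 / y)" using y by (simp add: field_simps)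
    then have "(y + 1) ^ degree p = y ^ degree p * (1 + 1 / y) ^ degree p"
      by (metis power_mult_distrib)
    also have "y ^ degree p = y ^ m * y ^ (degree p - m)"
      using m by (simp flip: power_add)
    finally show ?thesis by (simp add: ac_simps)
  qed
  ultimately have "y ^ m * (norm (coeff p m) * \<rho> ^ ?K)
     \<le> y ^ m * (y ^ (degree p - m) * (1 + 1 / y) ^ degree p * mahler p)"
    by (simp add: ac_simps)
  then show ?thesis
    using y unfolding \<rho>_def by (subst (asm) mult_le_cancel_left_pos) auto
qed (simp add: mahler_def)

text \<open>The constant coefficient is, up to sign, the leading one times the product of the roots.
  A root with \<open>norm z < r\<close> contributes less than r to it, but 1 to
  \<open>mahler p\<close>.\<close>

lemma size_small_roots_le:
  fixes r :: real
  assumes r: "0 < r" "r < 1"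
  shows "norm (coeff p 0) * (1 / r) ^ size {#z \<in># proots p. norm z < r#} \<le> mahler p"
proof -
  let ?A = "proots p"
  let ?J = "size {#z \<in># ?A. norm z < r#}"
  have 0: "coeff (\<Prod>z\<in>#?A. [:-z, 1:]) 0 = (\<Prod>z\<in>#?A. - z)"
    unfolding poly_0_coeff_0[symmetric] by (simp add: poly_prod_mset image_mset.compositionality o_def)
  have "norm (coeff p 0) = norm (lead_coeff p) * (\<Prod>z\<in>#?A. norm z)"
    by (subst (1) poly_eq_proots) (simp add: norm_mult 0 norm_prod_mset)
  then have "norm (coeff p 0) * (1 / r) ^ ?J
     = norm (lead_coeff p) * (\<Prod>z\<in>#?A. norm z * (if norm z < r then 1 / r else 1))"
    by (simp add: prod_mset_if_const prod_mset.distrib)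
  also have "\<dots> \<le> mahler p"
    unfolding mahler_def using r
    by (intro mult_left_mono conjunct2[OF prod_mset_nonneg_mono]) (auto simp: max_def divide_simps)
  finally show ?thesis .
qed

section \<open>Power sums of the inverse zeros\<close>

text \<open>The logarithmic derivative is the sum of the \<open>1 / (X - z)\<close>, and each of
  these expands into a geometric series in \<open>X / z\<close>, with sign -1. The identity is
  cleared of denominators.\<close>

lemma fps_deriv_prod_linear:
  fixes A :: "complex multiset"
  assumes "0 \<notin># A"
  defines "F \<equiv> fps_of_poly (\<Prod>z\<in>#A. [:-z, 1:])"
  shows "fps_deriv F = - F * Abs_fps (\<lambda>k. \<Sum>z\<in>#A. inverse z ^ Suc k)"
  using assms(1) unfolding F_def
proof (induction A)
  case empty
  show ?case by (simp add: fps_eq_iff)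
next
  case (add z A)
  let ?P = "fps_of_poly (\<Prod>z\<in>#A. [:-z, 1:])"
  let ?L = "fps_of_poly [:-z, 1:]"
  let ?S = "Abs_fps (\<lambda>k. \<Sum>z\<in>#A. inverse z ^ Suc k)"
  let ?G = "Abs_fps (\<lambda>k. inverse z ^ Suc k)"
  have IH: "fps_deriv ?P = - ?P * ?S" and z: "z \<noteq> 0"
    using add by auto
  have L: "?L = fps_X - fps_const z"
    by (simp add: fps_of_poly_pCons)
  have G: "?L * ?G = - 1"
  proof (rule fps_ext)
    show "(?L * ?G) $ n = (- 1) $ n" for n
      using z by (cases n) (auto simp: L algebra_simps)
  qed
  have S: "Abs_fps (\<lambda>k. \<Sum>z\<in>#add_mset z A. inverse z ^ Suc k) = ?G + ?S"
    by (simp add: fps_eq_iff)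
  have "fps_deriv (?L * ?P) = ?P + ?L * (- ?P * ?S)"
    by (simp add: L IH)
  also have "\<dots> = - (?L * ?G) * ?P - ?L * ?P * ?S"
    by (subst G) (simp add: algebra_simps)
  also have "\<dots> = - (?L * ?P) * (?G + ?S)"
    by (simp add: algebra_simps)
  finally show ?case
    unfolding S
    unfolding image_mset_add_mset prod_mset.add_mset fps_of_poly_mult .
qed

text \<open>Newton's identities for the reciprocals of the roots, read off from the logarithmic
  derivative at \<open>X ^ k\<close>. The degree of \<open>p\<close> does not occur in them.\<close>

lemma root_power_sum_recurrence:
  fixes p :: "complex poly"
  assumes "coeff p 0 \<noteq> 0"
  shows "(\<Sum>i\<le>k. coeff p i * (\<Sum>z\<in>#proots p. inverse z ^ Suc (k - i)))
    = - of_nat (Suc k) * coeff p (Suc k)"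
proof -
  let ?S = "Abs_fps (\<lambda>k. \<Sum>z\<in>#proots p. inverse z ^ Suc k)"
  have "p \<noteq> 0" using assms by auto
  then have 0: "0 \<notin># proots p"
    using assms by (simp add: poly_0_coeff_0)
  have p: "fps_of_poly p = fps_of_poly (\<Prod>z\<in>#proots p. [:-z, 1:]) * fps_const (lead_coeff p)"
    by (subst (1) poly_eq_proots) (simp add: fps_of_poly_mult fps_of_poly_smult)
  have "fps_deriv (fps_of_poly p) = - (fps_of_poly p * ?S)"
    unfolding p using fps_deriv_prod_linear[OF 0] by (simp add: algebra_simps)
  then have "fps_deriv (fps_of_poly p) $ k = - (fps_of_poly p * ?S) $ k"
    by simp
  then have "of_nat (Suc k) * coeff p (Suc k)
      = - (\<Sum>i\<le>k. coeff p i * (\<Sum>z\<in>#proots p. inverse z ^ Suc (k - i)))"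
    by (simp add: fps_mult_nth atMost_atLeast0 del: of_nat_Suc power_Suc)
  then show ?thesis
    by (simp del: of_nat_Suc power_Suc)
qed

section \<open>Location of the zeros for a deterministic coefficient sequence\<close>

lemma coeff_coeff_poly: "coeff (coeff_poly a n) k = (if k \<le> n then a k else 0)"
  by (simp add: coeff_poly_def coeff_sum coeff_monom)

lemma degree_coeff_poly_le: "degree (coeff_poly a n) \<le> n"
  by (rule degree_le) (simp add: coeff_coeff_poly)

text \<open>What the probabilistic part has to supply. The threshold \<delta> is fixed before
  \<epsilon>, so \<open>ln \<delta>\<close> is a constant and disappears after division by
  n.\<close>

locale coefficient_sequence =
  fixes a :: "nat \<Rightarrow> complex" and \<delta> :: real
  assumes growth: "\<And>\<epsilon>. \<epsilon> > 0 \<Longrightarrow> \<exists>C. \<forall>k. norm (a k) \<le> C * exp (\<epsilon> * real k)"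
    and delta_pos: "\<delta> > 0"
    and large_coeff: "\<And>\<epsilon>. \<epsilon> > 0 \<Longrightarrow>
      \<forall>\<^sub>F n in sequentially. \<exists>m\<le>n. real n - real m \<le> \<epsilon> * real n \<and> \<delta> \<le> norm (a m)"

locale coefficient_sequence_nz = coefficient_sequence +
  assumes a0: "a 0 \<noteq> 0"
begin

abbreviation G :: "nat \<Rightarrow> complex poly" where "G n \<equiv> coeff_poly a n"
abbreviation Z :: "nat \<Rightarrow> complex multiset" where "Z n \<equiv> proots (G n)"

lemma coeff_G_0: "coeff (G n) 0 = a 0"
  by (simp add: coeff_coeff_poly)

lemma G_nonzero: "G n \<noteq> 0"
  using coeff_G_0[of n] a0 by auto

lemma size_Z: "size (Z n) = degree (G n)"
  by (rule size_proots_complex)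

lemma size_Z_le: "size (Z n) \<le> n"
  unfolding size_Z by (rule degree_coeff_poly_le)

lemma mahler_G_le:
  assumes "\<epsilon> > 0"
  shows "\<forall>\<^sub>F n in sequentially. mahler (G n) \<le> exp (\<epsilon> * real n)"
proof -
  \<comment> \<open>Half of the exponent is kept in reserve to absorb the constant C and the number
    \<open>n + 1\<close> of coefficients.\<close>
  obtain C where C: "\<And>k. norm (a k) \<le> C * exp (\<epsilon> / 2 * real k)"
    using growth[of "\<epsilon> / 2"] assms by auto
  have C0: "0 < C"
    using C[of 0] a0 by simp (metis order_less_le_trans zero_less_norm_iff)
  have bound: "(mahler (G n))\<^sup>2 \<le> (real n + 1) * (C * exp (\<epsilon> / 2 * real n))\<^sup>2" for n
  proof -
    have "(mahler (G n))\<^sup>2 \<le> (\<Sum>i\<le>n. (norm (coeff (G n) i))\<^sup>2)"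
      using landau_inequality coeff_sq_sum_eq[OF degree_coeff_poly_le] by metis
    also have "\<dots> \<le> (\<Sum>i\<le>n. (C * exp (\<epsilon> / 2 * real n))\<^sup>2)"
    proof (rule sum_mono)
      fix i assume "i \<in> {..n}"
      then have "C * exp (\<epsilon> / 2 * real i) \<le> C * exp (\<epsilon> / 2 * real n)"
        using C0 assms by simp
      then show "(norm (coeff (G n) i))\<^sup>2 \<le> (C * exp (\<epsilon> / 2 * real n))\<^sup>2"
        using order_trans[OF C[of i]] \<open>i \<in> {..n}\<close> by (intro power_mono) (auto simp: coeff_coeff_poly)
    qed
    finally show ?thesis by (simp add: add.commute)
  qed
  have "\<forall>\<^sub>F n in sequentially. (real n + 1) * (C * exp (\<epsilon> / 2 * real n))\<^sup>2 \<le> (exp (\<epsilon> * real n))\<^sup>2"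
    using assms C0 by real_asymp
  then show ?thesis
  proof eventually_elim
    case (elim n)
    show ?case
      by (rule power2_le_imp_le) (use bound[of n] elim in auto)
  qed
qed

lemma few_small_roots:
  assumes "0 < r" "r < 1" "\<tau> > 0"
  shows "\<forall>\<^sub>F n in sequentially. real (size {#z \<in># Z n. norm z < r#}) \<le> \<tau> * real n"
proof -
  \<comment> \<open>The logarithmic gain per small root. Of the budget
    \<open>l * \<tau> * n\<close>, one half pays for the Mahler measure and the other for the
    constant \<open>- ln (norm (a 0))\<close>.\<close>
  define l where "l = ln (1 / r)"
  have l: "l > 0" using assms by (simp add: l_def)
  have "\<forall>\<^sub>F n in sequentially. mahler (G n) \<le> exp (\<tau> * l / 2 * real n)"
    by (rule mahler_G_le) (use l assms in auto)
  moreover have "\<forall>\<^sub>F n in sequentially. \<tau> * l / 2 * real n - ln (norm (a 0)) \<le> l * (\<tau> * real n)"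
    using l assms by real_asymp
  ultimately show ?thesis
  proof eventually_elim
    case (elim n)
    let ?J = "size {#z \<in># Z n. norm z < r#}"
    have "norm (a 0) * (1 / r) ^ ?J \<le> exp (\<tau> * l / 2 * real n)"
      using size_small_roots_le[OF assms(1,2), of "G n"] elim(1) by (simp add: coeff_G_0)
    then have "ln (norm (a 0) * (1 / r) ^ ?J) \<le> \<tau> * l / 2 * real n"
      using assms a0 by (subst ln_exp[symmetric], subst ln_le_cancel_iff) auto
    then have "ln (norm (a 0)) + real ?J * l \<le> \<tau> * l / 2 * real n"
      using assms a0 by (simp add: ln_mult_pos ln_realpow l_def del: ln_inverse ln_div)
    then have "l * real ?J \<le> l * (\<tau> * real n)"
      using elim(2) by (simp add: ac_simps)
    then show ?case
      using l by simp
  qed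
qed

lemma few_missing_roots:
  assumes "\<tau> > 0"
  shows "\<forall>\<^sub>F n in sequentially. real n - real (size (Z n)) \<le> \<tau> * real n"
  using large_coeff[OF assms]
proof eventually_elim
  case (elim n)
  then obtain m where m: "m \<le> n" "real n - real m \<le> \<tau> * real n" "\<delta> \<le> norm (a m)"
    by auto
  have "m \<le> degree (G n)"
    by (rule le_degree) (use m delta_pos in \<open>auto simp: coeff_coeff_poly\<close>)
  then show ?case
    using m by (simp add: size_Z)
qed

lemma few_large_roots:
  assumes R: "R > 1" and \<tau>: "\<tau> > 0"
  shows "\<forall>\<^sub>F n in sequentially. real (size {#z \<in># Z n. norm z > R#}) \<le> \<tau> * real n"
proof -
  define l where "l = ln (2 * R / (R + 1))"
  have l: "l > 0" using R by (simp add: l_def)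
  \<comment> \<open>The budget \<open>l * \<tau> * n\<close> is split into quarters. The choice of y
    limits \<open>(1 + 1 / y) ^ d\<close> to one of them, and the later choice of \<epsilon> limits
    \<open>y ^ (d - m)\<close> to another. The Mahler measure takes the third,
    \<open>- ln \<delta>\<close> the last. The 2 makes \<open>ln y\<close> positive.\<close>
  define y where "y = max 2 (4 / (l * \<tau>))"
  have y: "y \<ge> 2" by (simp add: y_def)
  have y': "1 / y \<le> l * \<tau> / 4"
    using l \<tau> by (auto simp: y_def max_def field_simps)
  define \<epsilon> where "\<epsilon> = l * \<tau> / (4 * ln y)"
  have \<epsilon>: "\<epsilon> > 0" using l \<tau> y by (simp add: \<epsilon>_def)
  have \<epsilon>': "\<epsilon> * ln y = l * \<tau> / 4" using y by (simp add: \<epsilon>_def)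
  have "\<forall>\<^sub>F n in sequentially. mahler (G n) \<le> exp (l * \<tau> / 4 * real n)"
    by (rule mahler_G_le) (use l \<tau> in auto)
  moreover note large_coeff[OF \<epsilon>]
  moreover have "\<forall>\<^sub>F n in sequentially. 3 * (l * \<tau> / 4) * real n - ln \<delta> \<le> l * (\<tau> * real n)"
    using l \<tau> by real_asymp
  ultimately show ?thesis
  proof eventually_elim
    case (elim n)
    let ?K = "size {#z \<in># Z n. norm z > R#}"
    define d where "d = degree (G n)"
    define \<rho> where "\<rho> = 2 * R / (R + 1)"
    have \<rho>: "\<rho> > 0" using R by (simp add: \<rho>_def)
    have dn: "d \<le> n" unfolding d_def by (rule degree_coeff_poly_le)
    obtain m where m: "m \<le> n" "real n - real m \<le> \<epsilon> * real n" "\<delta> \<le> norm (a m)"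
      using elim by auto
    have md: "m \<le> d" unfolding d_def
      by (rule le_degree) (use m delta_pos in \<open>auto simp: coeff_coeff_poly\<close>)
    have y1: "0 < 1 + 1 / y" using y by (simp add: add_pos_pos)
    have "\<delta> * \<rho> ^ ?K \<le> norm (coeff (G n) m) * \<rho> ^ ?K"
      using m \<rho> by (intro mult_right_mono) (auto simp: coeff_coeff_poly)
    also have "\<dots> \<le> y ^ (d - m) * (1 + 1 / y) ^ d * mahler (G n)"
      unfolding d_def \<rho>_def by (rule size_large_roots_le) (use R y md in \<open>auto simp: d_def\<close>)
    also have "\<dots> \<le> y ^ (d - m) * (1 + 1 / y) ^ d * exp (l * \<tau> / 4 * real n)"
      using y elim by (intro mult_left_mono) auto
    finally have "ln (\<delta> * \<rho> ^ ?K) \<le> ln (y ^ (d - m) * (1 + 1 / y) ^ d * exp (l * \<tau> / 4 * real n))"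
      using \<rho> delta_pos by (subst ln_le_cancel_iff) (use y y1 in \<open>auto intro!: mult_pos_pos\<close>)
    moreover have "ln (\<delta> * \<rho> ^ ?K) = ln \<delta> + real ?K * l"
      using \<rho> delta_pos by (simp add: ln_mult_pos ln_realpow l_def \<rho>_def del: ln_div)
    moreover have "ln (y ^ (d - m) * (1 + 1 / y) ^ d * exp (l * \<tau> / 4 * real n))
       = real (d - m) * ln y + real d * ln (1 + 1 / y) + l * \<tau> / 4 * real n"
      using y y1 by (simp add: ln_mult_pos ln_realpow del: ln_div)
    moreover have "real (d - m) * ln y \<le> (\<epsilon> * real n) * ln y"
      using m md dn y by (intro mult_right_mono) auto
    then have "real (d - m) * ln y \<le> l * \<tau> / 4 * real n"
      unfolding \<epsilon>'[symmetric] by (simp only: ac_simps)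
    moreover have "real d * ln (1 + 1 / y) \<le> real n * (l * \<tau> / 4)"
    proof (intro mult_mono)
      show "ln (1 + 1 / y) \<le> l * \<tau> / 4"
        using y' y ln_add_one_self_le_self[of "1 / y"] by simp
    qed (use dn y in auto)
    ultimately have "l * real ?K \<le> 3 * (l * \<tau> / 4) * real n - ln \<delta>"
      by (simp add: algebra_simps)
    then have "l * real ?K \<le> l * (\<tau> * real n)"
      using elim by simp
    then show ?case
      using l by simp
  qed
qed

text \<open>Near 0 the constant term dominates the rest of every \<open>G n\<close>, because a
  single geometric majorant serves all n. This keeps inverse powers bounded on the zeros.\<close>

lemma roots_bounded_below: "\<exists>c>0. \<forall>n. \<forall>z\<in>#Z n. c \<le> norm z"
proof -
  obtain C where C: "\<And>k. norm (a k) \<le> C * exp (ln 2 * real k)"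
    using growth[of "ln 2"] by auto
  have C': "norm (a k) \<le> C * 2 ^ k" for k
    using C[of k] by (simp add: exp_of_nat2_mult)
  have C0: "0 < C"
    using C'[of 0] a0 by simp (metis order_less_le_trans zero_less_norm_iff)
  \<comment> \<open>With \<open>norm (a k) \<le> C * 2 ^ k\<close>, the 1/4 gives the remaining
    terms the ratio 1/2, so they sum to at most \<open>4 * C * norm z\<close>; the second entry
    makes that less than \<open>norm (a 0)\<close>.\<close>
  define c where "c = min (1 / 4) (norm (a 0) / (4 * C))"
  have c: "c > 0" using C0 a0 by (simp add: c_def)
  have "c \<le> norm z" if "poly (G n) z = 0" for n z
  proof (rule ccontr)
    assume "\<not> c \<le> norm z"
    then have z: "norm z < 1 / 4" "norm z < norm (a 0) / (4 * C)"
      by (auto simp: c_def)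
    have "0 = a 0 + (\<Sum>k<n. a (Suc k) * z ^ Suc k)"
      using that unfolding poly_coeff_poly by (subst (asm) sum.atMost_shift) simp
    then have "norm (a 0) = norm (\<Sum>k<n. a (Suc k) * z ^ Suc k)"
      by (metis add_eq_0_iff norm_minus_cancel)
    also have "\<dots> \<le> (\<Sum>k<n. 2 * C * norm z * (1 / 2) ^ k)"
    proof (rule sum_norm_le)
      fix k
      have "norm (a (Suc k)) * norm z ^ Suc k \<le> (C * 2 ^ Suc k) * (norm z * (1 / 4) ^ k)"
        using C'[of "Suc k"] C0 z
        by (intro mult_mono) (auto intro!: mult_left_mono power_mono)
      also have "\<dots> = 2 * C * norm z * (2 * (1 / 4)) ^ k"
        unfolding power_mult_distrib by simp
      finally show "norm (a (Suc k) * z ^ Suc k) \<le> 2 * C * norm z * (1 / 2) ^ k"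
        by (simp add: norm_mult norm_power)
    qed
    also have "\<dots> = 2 * C * norm z * (\<Sum>k<n. (1 / 2) ^ k)"
      by (simp add: sum_distrib_left)
    also have "\<dots> \<le> 2 * C * norm z * 2"
    proof (rule mult_left_mono)
      have "(\<Sum>k<n. (1 / 2 :: real) ^ k) \<le> (\<Sum>k. (1 / 2) ^ k)"
        by (rule sum_le_suminf) (auto intro: summable_geometric)
      also have "\<dots> = 2"
        by (subst suminf_geometric) auto
      finally show "(\<Sum>k<n. (1 / 2 :: real) ^ k) \<le> 2" .
    qed (use C0 in auto)
    also have "\<dots> < norm (a 0)"
      using z C0 by (simp add: field_simps)
    finally show False by simp
  qed
  then show ?thesis
    using c G_nonzero by auto
qed

text \<open>The recurrence determines each power sum from the earlier ones and the coefficients up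
  to index \<open>Suc k\<close>. For \<open>n > k\<close> the latter are entries of
  \<open>a\<close>, so the bound is free of n.\<close>

lemma inverse_power_sums_bounded:
  "\<exists>B. \<forall>n>k. norm (\<Sum>z\<in>#Z n. inverse z ^ Suc k) \<le> B"
proof (induction k rule: less_induct)
  case (less k)
  then obtain B where B: "\<And>j n. j < k \<Longrightarrow> n > j \<Longrightarrow> norm (\<Sum>z\<in>#Z n. inverse z ^ Suc j) \<le> B j"
    by metis
  \<comment> \<open>The triangle inequality for the recurrence, solved for its term
    \<open>i = 0\<close>.\<close>
  define b where "b = (norm (of_nat (Suc k) * a (Suc k)) + (\<Sum>i<k. norm (a (Suc i)) * B (k - Suc i))) / norm (a 0)"
  have "norm (\<Sum>z\<in>#Z n. inverse z ^ Suc k) \<le> b" if n: "n > k" for n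
  proof -
    define S where "S j = (\<Sum>z\<in>#Z n. inverse z ^ Suc j)" for j
    have SB: "norm (S j) \<le> B j" if "j < k" for j
      unfolding S_def using that n by (intro B) auto
    have "(\<Sum>i\<le>k. a i * S (k - i)) = (\<Sum>i\<le>k. coeff (G n) i * S (k - i))"
      using n by (intro sum.cong) (auto simp: coeff_coeff_poly)
    also have "\<dots> = - of_nat (Suc k) * coeff (G n) (Suc k)"
      unfolding S_def by (rule root_power_sum_recurrence) (use a0 in \<open>simp add: coeff_G_0\<close>)
    also have "coeff (G n) (Suc k) = a (Suc k)"
      using n by (simp add: coeff_coeff_poly)
    finally have "a 0 * S k + (\<Sum>i<k. a (Suc i) * S (k - Suc i)) = - of_nat (Suc k) * a (Suc k)"
      by (subst (asm) sum.atMost_shift) simp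
    then have "a 0 * S k = - (of_nat (Suc k) * a (Suc k) + (\<Sum>i<k. a (Suc i) * S (k - Suc i)))"
      by (simp only: minus_add_distrib add_uminus_conv_diff eq_diff_eq mult_minus_left)
    then have "norm (a 0) * norm (S k)
        = norm (of_nat (Suc k) * a (Suc k) + (\<Sum>i<k. a (Suc i) * S (k - Suc i)))"
      by (metis norm_minus_cancel norm_mult)
    also have "\<dots> \<le> norm (of_nat (Suc k) * a (Suc k)) + norm (\<Sum>i<k. a (Suc i) * S (k - Suc i))"
      by (rule norm_triangle_ineq)
    also have "norm (\<Sum>i<k. a (Suc i) * S (k - Suc i)) \<le> (\<Sum>i<k. norm (a (Suc i)) * B (k - Suc i))"
      unfolding norm_mult[symmetric]
      by (intro sum_norm_le) (simp add: norm_mult mult_left_mono SB)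
    finally have "norm (a 0) * norm (S k) \<le> b * norm (a 0)"
      using a0 by (simp add: b_def)
    then have "norm (S k) \<le> b"
      using a0 by (simp add: mult.commute)
    then show ?thesis
      by (simp only: S_def)
  qed
  then show ?case by blast
qed

end

lemma norm_sum_mset_le:
  fixes h :: "'a \<Rightarrow> 'b :: real_normed_vector"
  assumes "\<And>z. z \<in># A \<Longrightarrow> norm (h z) \<le> e + (if P z then b else 0) + (if Q z then b else 0)"
  shows "norm (\<Sum>z\<in>#A. h z)
    \<le> e * size A + b * size (filter_mset P A) + b * size (filter_mset Q A)"
  using assms
proof (induction A)
  case (add z A)
  have "norm (\<Sum>z\<in>#add_mset z A. h z) \<le> norm (h z) + norm (\<Sum>z\<in>#A. h z)"
    by (simp add: norm_triangle_ineq)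
  also have "\<dots> \<le> (e + (if P z then b else 0) + (if Q z then b else 0))
      + (e * size A + b * size (filter_mset P A) + b * size (filter_mset Q A))"
    using add by (intro add_mono) auto
  also have "\<dots> = e * size (add_mset z A) + b * size (filter_mset P (add_mset z A))
      + b * size (filter_mset Q (add_mset z A))"
    by (simp add: algebra_simps)
  finally show ?case .
qed auto

lemma sum_mset_diff:
  fixes f g :: "'a \<Rightarrow> 'b :: ab_group_add"
  shows "(\<Sum>z\<in>#A. f z - g z) = (\<Sum>z\<in>#A. f z) - (\<Sum>z\<in>#A. g z)"
  by (induction A) auto

lemma cnj_sum_mset: "cnj (\<Sum>z\<in>#A. f z) = (\<Sum>z\<in>#A. cnj (f z))"
  by (induction A) auto

lemma of_real_sum_mset:
  "(of_real (\<Sum>z\<in>#A. f z) :: 'b :: real_algebra_1) = (\<Sum>z\<in>#A. of_real (f z))"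
  by (induction A) auto

section \<open>Laurent polynomials on the unit circle\<close>

text \<open>On the circle \<open>cnj z = 1 / z\<close>, so a real polynomial in the two coordinates
  becomes a Laurent polynomial, encoded as a polynomial over a power of z.\<close>

lemma real_polynomial_function_circle:
  fixes q :: "complex \<Rightarrow> real"
  assumes "real_polynomial_function q"
  shows "\<exists>P N. \<forall>z. norm z = 1 \<longrightarrow> of_real (q z) = poly P z / z ^ N"
  using assms
proof (induction rule: real_polynomial_function.induct)
  case (linear f)
  then interpret bounded_linear f .
  \<comment> \<open>Chosen so that the real linear form is
    \<open>f z = \<alpha> * z + cnj \<alpha> * cnj z\<close>.\<close>
  define \<alpha> where "\<alpha> = Complex (f 1 / 2) (- f \<i> / 2)"
  have "of_real (f z) = poly [:cnj \<alpha>, 0, \<alpha>:] z / z ^ 1" if z: "norm z = 1" for z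
  proof -
    have "f z = f (Re z *\<^sub>R 1 + Im z *\<^sub>R \<i>)"
      by (simp add: scaleR_conv_of_real mult.commute complex_eq[symmetric])
    also have "\<dots> = Re z * f 1 + Im z * f \<i>"
      by (simp add: add scaleR)
    finally have "of_real (f z) = \<alpha> * z + cnj \<alpha> * cnj z"
      by (simp add: \<alpha>_def complex_eq_iff)
    moreover have "cnj z * z = 1"
      using complex_norm_square[of z] z by (simp add: mult.commute)
    moreover have "z \<noteq> 0" using z by auto
    ultimately show ?thesis
      by (simp add: field_simps)
  qed
  then show ?case by blast
next
  case (const c)
  have "of_real c = poly [:of_real c:] z / z ^ 0" for z :: complex
    by simp
  then show ?case by blast
next
  case (add f g)
  then obtain P N P' N' where
    *: "\<And>z. norm z = 1 \<Longrightarrow> of_real (f z) = poly P z / z ^ N"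
       "\<And>z. norm z = 1 \<Longrightarrow> of_real (g z) = poly P' z / z ^ N'"
    by blast
  have "of_real (f z + g z) = poly (P * monom 1 N' + P' * monom 1 N) z / z ^ (N + N')"
    if "norm z = 1" for z
  proof -
    have "z \<noteq> 0" using that by auto
    then show ?thesis
      using *[OF that] by (simp add: poly_monom power_add field_simps)
  qed
  then show ?case by blast
next
  case (mult f g)
  then obtain P N P' N' where
    *: "\<And>z. norm z = 1 \<Longrightarrow> of_real (f z) = poly P z / z ^ N"
       "\<And>z. norm z = 1 \<Longrightarrow> of_real (g z) = poly P' z / z ^ N'"
    by blast
  have "of_real (f z * g z) = poly (P * P') z / z ^ (N + N')" if "norm z = 1" for z
    using *[OF that] by (simp add: power_add)
  then show ?case by blast
qed

lemma has_integral_cis_monomial: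
  "((\<lambda>t. cis t ^ i / cis t ^ N) has_integral (if i = N then of_real (2 * pi) else 0)) {0..2 * pi}"
proof (cases "i = N")
  case True
  then show ?thesis
    using has_integral_const_real[of "1 :: complex" 0 "2 * pi"] by (simp add: scaleR_conv_of_real)
next
  case False
  define k :: real where "k = real i - real N"
  have k: "k \<noteq> 0" using False by (simp add: k_def)
  have eq: "cis t ^ i / cis t ^ N = cis (k * t)" for t
    by (simp add: Complex.DeMoivre cis_divide k_def algebra_simps)
  have "((\<lambda>t. cis (k * t)) has_integral
      (cis (k * (2 * pi)) / (\<i> * of_real k) - cis (k * 0) / (\<i> * of_real k))) {0..2 * pi}"
  proof (rule fundamental_theorem_of_calculus)
    fix t
    have "((\<lambda>w. exp (\<i> * of_real k * w) / (\<i> * of_real k)) has_field_derivative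
        exp (\<i> * of_real k * of_real t)) (at (of_real t))"
      using k by (auto intro!: derivative_eq_intros)
    then have "((\<lambda>t. exp (\<i> * of_real k * of_real t) / (\<i> * of_real k)) has_vector_derivative
        exp (\<i> * of_real k * of_real t)) (at t within {0..2 * pi})"
      by (rule has_vector_derivative_real_field)
    then show "((\<lambda>t. cis (k * t) / (\<i> * of_real k)) has_vector_derivative cis (k * t))
        (at t within {0..2 * pi})"
      by (simp add: cis_conv_exp mult.assoc)
  qed simp
  moreover have "cis (k * (2 * pi)) = 1"
  proof -
    \<comment> \<open>As k is typed as a real number, periodicity is obtained from the quotient of
      natural powers.\<close>
    have "cis (k * (2 * pi)) = cis (2 * pi) ^ i / cis (2 * pi) ^ N"
      by (simp only: eq)
    then show ?thesis by simp
  qed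
  ultimately show ?thesis
    using False by (simp add: eq)
qed

lemma poly_eq_sum_le:
  fixes x :: "'a :: comm_semiring_1"
  assumes "degree p \<le> n"
  shows "poly p x = (\<Sum>i\<le>n. coeff p i * x ^ i)"
  by (subst (1) poly_as_sum_of_monoms'[OF assms, symmetric]) (simp add: poly_sum poly_monom)

lemma has_integral_cis_Laurent_poly:
  "((\<lambda>t. poly P (cis t) / cis t ^ N) has_integral of_real (2 * pi) * coeff P N) {0..2 * pi}"
proof -
  \<comment> \<open>The maximum keeps the index N in range even when it exceeds the degree.\<close>
  have "((\<lambda>t. \<Sum>i\<le>max N (degree P). coeff P i * (cis t ^ i / cis t ^ N)) has_integral
      (\<Sum>i\<le>max N (degree P). coeff P i * (if i = N then of_real (2 * pi) else 0))) {0..2 * pi}"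
    by (intro has_integral_sum has_integral_mult_right has_integral_cis_monomial) auto
  moreover have "(\<Sum>i\<le>max N (degree P). coeff P i * (cis t ^ i / cis t ^ N))
      = poly P (cis t) / cis t ^ N" for t
    by (simp add: poly_eq_sum_le[of P "max N (degree P)"] sum_divide_distrib)
  ultimately show ?thesis
    by (simp add: if_distrib mult.commute cong: if_cong)
qed

section \<open>Equidistribution of the arguments\<close>

context coefficient_sequence_nz
begin

lemma Z_nonzero: "z \<in># Z n \<Longrightarrow> z \<noteq> 0"
  using a0 G_nonzero by (auto simp: poly_0_coeff_0 coeff_coeff_poly)

text \<open>Uniform continuity handles the zeros in a thin annulus about the circle. The others are
  o(n) in number and contribute boundedly, since all zeros stay away from 0. The hypotheses on h
  admit inverse powers as well as bounded continuous functions.\<close>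

lemma radial_projection_average:
  fixes h :: "complex \<Rightarrow> complex"
  assumes cont: "continuous_on (- {0}) h"
    and bdd: "\<And>c. c > 0 \<Longrightarrow> \<exists>B. \<forall>z. norm z \<ge> c \<longrightarrow> norm (h z) \<le> B"
  shows "(\<lambda>n. (\<Sum>z\<in>#Z n. h z - h (sgn z)) / of_nat n) \<longlonglongrightarrow> 0"
proof (rule LIMSEQ_I)
  fix \<epsilon> :: real assume \<epsilon>: "\<epsilon> > 0"
  obtain c where c: "c > 0" "\<And>n z. z \<in># Z n \<Longrightarrow> c \<le> norm z"
    using roots_bounded_below by blast
  \<comment> \<open>The minimum with 1 makes B also bound h at the projections
    \<open>sgn z\<close>.\<close>
  obtain B where B: "\<And>z. norm z \<ge> min c 1 \<Longrightarrow> norm (h z) \<le> B"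
    using bdd[of "min c 1"] c by auto
  have B0: "B \<ge> 0"
    using order_trans[OF norm_ge_zero B[of 1]] by simp
  let ?T = "cball 0 2 - ball 0 (1 / 2) :: complex set"
  have "uniformly_continuous_on ?T h"
    by (intro compact_uniformly_continuous continuous_on_subset[OF cont] compact_diff) auto
  then obtain d where d: "d > 0"
    "\<And>z w. z \<in> ?T \<Longrightarrow> w \<in> ?T \<Longrightarrow> dist w z < d \<Longrightarrow> dist (h w) (h z) < \<epsilon> / 4"
    unfolding uniformly_continuous_on_def using \<epsilon> by (metis zero_less_divide_iff zero_less_numeral)
  \<comment> \<open>At most 1/2, so that the thin annulus lies in the compact set
    \<open>?T\<close>.\<close>
  define \<eta> where "\<eta> = min (d / 2) (1 / 2)"
  have \<eta>: "0 < \<eta>" "\<eta> < d" "\<eta> \<le> 1 / 2" using d by (auto simp: \<eta>_def)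
  \<comment> \<open>Two exceptional families, each costing at most
    \<open>2 * B * \<tau> * n\<close>, then cost at most \<open>\<epsilon> / 4 * n\<close>
    together.\<close>
  define \<tau> where "\<tau> = \<epsilon> / (16 * (B + 1))"
  have \<tau>: "\<tau> > 0" using \<epsilon> B0 by (simp add: \<tau>_def)
  have *: "norm (h z - h (sgn z)) \<le> \<epsilon> / 4 + (if norm z < 1 - \<eta> then 2 * B else 0)
      + (if norm z > 1 + \<eta> then 2 * B else 0)" if "z \<in># Z n" for z n
  proof (cases "norm z < 1 - \<eta> \<or> norm z > 1 + \<eta>")
    case True
    have "norm (h z - h (sgn z)) \<le> norm (h z) + norm (h (sgn z))"
      by (rule norm_triangle_ineq4)
    also have "\<dots> \<le> B + B"
      using c(2)[OF that] Z_nonzero[OF that] by (intro add_mono B) (auto simp: norm_sgn)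
    finally show ?thesis
      using True \<epsilon> B0 by auto
  next
    case False
    have "dist z (sgn z) = norm (of_real (norm z - 1) * sgn z)"
    proof -
      have "z = of_real (norm z) * sgn z"
        using Z_nonzero[OF that] by (simp add: sgn_eq)
      then have "z - sgn z = of_real (norm z - 1) * sgn z"
        by (simp add: algebra_simps)
      then show ?thesis by (simp add: dist_norm)
    qed
    also have "\<dots> \<le> \<eta>"
      using False Z_nonzero[OF that] by (simp add: norm_mult norm_sgn abs_le_iff del: of_real_diff)
    finally have "dist z (sgn z) < d"
      using \<eta> by simp
    then have "dist (h z) (h (sgn z)) < \<epsilon> / 4"
      using False Z_nonzero[OF that] \<eta> by (intro d) (auto simp: norm_sgn)
    then show ?thesis
      using B0 by (auto simp: dist_norm)
  qed
  have "\<forall>\<^sub>F n in sequentially. real (size {#z \<in># Z n. norm z < 1 - \<eta>#}) \<le> \<tau> * real n"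
    by (rule few_small_roots) (use \<eta> \<tau> in auto)
  moreover have "\<forall>\<^sub>F n in sequentially. real (size {#z \<in># Z n. norm z > 1 + \<eta>#}) \<le> \<tau> * real n"
    by (rule few_large_roots) (use \<eta> \<tau> in auto)
  ultimately have "\<forall>\<^sub>F n in sequentially. norm ((\<Sum>z\<in>#Z n. h z - h (sgn z)) / of_nat n - 0) < \<epsilon>"
    using eventually_gt_at_top[of 0]
  proof eventually_elim
    case (elim n)
    have "norm (\<Sum>z\<in>#Z n. h z - h (sgn z)) \<le> \<epsilon> / 4 * size (Z n)
      + 2 * B * size {#z \<in># Z n. norm z < 1 - \<eta>#} + 2 * B * size {#z \<in># Z n. norm z > 1 + \<eta>#}"
      by (rule norm_sum_mset_le) (rule *)
    also have "\<dots> \<le> \<epsilon> / 4 * n + 2 * B * (\<tau> * n) + 2 * B * (\<tau> * n)"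
      using elim \<epsilon> B0 size_Z_le[of n] by (intro add_mono mult_left_mono) auto
    also have "\<dots> = (\<epsilon> / 4 + 4 * (B * \<tau>)) * n"
      by (simp add: algebra_simps)
    also have "\<dots> \<le> \<epsilon> / 2 * n"
    proof (rule mult_right_mono)
      have "4 * (B * \<tau>) \<le> \<epsilon> / 4"
        using \<epsilon> B0 by (simp add: \<tau>_def field_simps)
      then show "\<epsilon> / 4 + 4 * (B * \<tau>) \<le> \<epsilon> / 2" by simp
    qed simp
    also have "\<dots> < \<epsilon> * n" using \<epsilon> elim by simp
    finally show ?case
      using elim by (simp add: norm_divide field_simps)
  qed
  then show "\<exists>no. \<forall>n\<ge>no. norm ((\<Sum>z\<in>#Z n. h z - h (sgn z)) / of_nat n - 0) < \<epsilon>"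
    by (simp add: eventually_sequentially)
qed

lemma average_inverse_power:
  "(\<lambda>n. (\<Sum>z\<in>#Z n. inverse (sgn z) ^ Suc k) / of_nat n) \<longlonglongrightarrow> 0"
proof -
  let ?h = "\<lambda>z :: complex. inverse z ^ Suc k"
  obtain B where B: "\<And>n. n > k \<Longrightarrow> norm (\<Sum>z\<in>#Z n. ?h z) \<le> B"
    using inverse_power_sums_bounded[of k] by blast
  have "(\<lambda>n. (\<Sum>z\<in>#Z n. ?h z) / of_nat n) \<longlonglongrightarrow> 0"
  proof (rule Lim_null_comparison)
    show "\<forall>\<^sub>F n in sequentially. norm ((\<Sum>z\<in>#Z n. ?h z) / of_nat n) \<le> B / real n"
      using eventually_gt_at_top[of k]
      by eventually_elim (use B in \<open>simp add: norm_divide divide_right_mono del: power_Suc\<close>)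
    show "(\<lambda>n. B / real n) \<longlonglongrightarrow> 0"
      by real_asymp
  qed
  moreover have "(\<lambda>n. (\<Sum>z\<in>#Z n. ?h z - ?h (sgn z)) / of_nat n) \<longlonglongrightarrow> 0"
  proof (rule radial_projection_average)
    show "continuous_on (- {0}) ?h"
      by (intro continuous_intros) auto
    fix c :: real assume c: "c > 0"
    have "norm (?h z) \<le> inverse c ^ Suc k" if "norm z \<ge> c" for z
      unfolding norm_power norm_inverse using that c
      by (intro power_mono le_imp_inverse_le) auto
    then show "\<exists>B. \<forall>z. norm z \<ge> c \<longrightarrow> norm (?h z) \<le> B" by blast
  qed
  ultimately have "(\<lambda>n. (\<Sum>z\<in>#Z n. ?h z) / of_nat n - (\<Sum>z\<in>#Z n. ?h z - ?h (sgn z)) / of_nat n)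
      \<longlonglongrightarrow> 0 - 0"
    by (rule tendsto_diff)
  then show ?thesis
    unfolding sum_mset_diff by (simp add: diff_divide_distrib del: power_Suc)
qed

text \<open>The frequency 0: the degree may fall short of n, but only by o(n), so no mass is lost in
  the limit.\<close>

lemma average_one: "(\<lambda>n. real (size (Z n)) / real n) \<longlonglongrightarrow> 1"
proof (rule LIMSEQ_I)
  fix \<epsilon> :: real assume \<epsilon>: "\<epsilon> > 0"
  have "\<epsilon> / 2 > 0" using \<epsilon> by simp
  from few_missing_roots[OF this] eventually_gt_at_top[of 0]
  have "\<forall>\<^sub>F n in sequentially. norm (real (size (Z n)) / real n - 1) < \<epsilon>"
  proof eventually_elim
    case (elim n)
    have "norm (real (size (Z n)) / real n - 1) = (real n - real (size (Z n))) / real n"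
      using elim size_Z_le[of n] by (simp add: field_simps)
    also have "\<dots> \<le> \<epsilon> / 2"
      using elim by (simp add: field_simps)
    finally show ?case using \<epsilon> by simp
  qed
  then show "\<exists>no. \<forall>n\<ge>no. norm (real (size (Z n)) / real n - 1) < \<epsilon>"
    by (simp add: eventually_sequentially)
qed

text \<open>For \<open>i < N\<close> this is \<open>average_inverse_power\<close>. For
  \<open>i > N\<close> it is the conjugate of that, as \<open>cnj (inverse w) = w\<close> on the
  unit circle.\<close>

lemma average_monomial:
  "(\<lambda>n. (\<Sum>z\<in>#Z n. sgn z ^ i / sgn z ^ N) / of_nat n) \<longlonglongrightarrow> (if i = N then 1 else 0)"
proof -
  consider "i = N" | k where "N = i + Suc k" | k where "i = N + Suc k"
    by (metis less_iff_Suc_add add_Suc_right nat_neq_iff)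
  then show ?thesis
  proof cases
    case 1
    have "(\<Sum>z\<in>#Z n. sgn z ^ i / sgn z ^ N) = of_nat (size (Z n))" for n
    proof -
      have "(\<Sum>z\<in>#Z n. sgn z ^ i / sgn z ^ N) = (\<Sum>z\<in>#Z n. 1)"
        using 1 Z_nonzero by (intro arg_cong[where f = sum_mset] image_mset_cong) (auto simp: sgn_zero_iff)
      then show ?thesis by simp
    qed
    moreover have "(\<lambda>n. of_real (real (size (Z n)) / real n)) \<longlonglongrightarrow> (of_real 1 :: complex)"
      by (intro tendsto_of_real average_one)
    ultimately show ?thesis using 1 by simp
  next
    case 2
    have "(\<Sum>z\<in>#Z n. sgn z ^ i / sgn z ^ N) = (\<Sum>z\<in>#Z n. inverse (sgn z) ^ Suc k)" for n
      using 2 Z_nonzero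
      by (intro arg_cong[where f = sum_mset] image_mset_cong)
         (auto simp: sgn_zero_iff power_add field_simps)
    then show ?thesis
      using average_inverse_power[of k] 2 by simp
  next
    case 3
    have "(\<Sum>z\<in>#Z n. sgn z ^ i / sgn z ^ N) = cnj (\<Sum>z\<in>#Z n. inverse (sgn z) ^ Suc k)" for n
    proof -
      have "cnj (\<Sum>z\<in>#Z n. inverse (sgn z) ^ Suc k) = (\<Sum>z\<in>#Z n. cnj (inverse (sgn z) ^ Suc k))"
        by (rule cnj_sum_mset)
      also have "\<dots> = (\<Sum>z\<in>#Z n. sgn z ^ i / sgn z ^ N)"
      proof (intro arg_cong[where f = sum_mset] image_mset_cong)
        fix z assume "z \<in># Z n"
        then have z: "sgn z \<noteq> 0" "norm (sgn z) = 1"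
          using Z_nonzero by (auto simp: sgn_zero_iff norm_sgn)
        then have "cnj (inverse (sgn z)) = sgn z"
          by (simp add: complex_cnj_inverse inverse_eq_divide divide_conv_cnj)
        then show "cnj (inverse (sgn z) ^ Suc k) = sgn z ^ i / sgn z ^ N"
          using z 3 by (simp add: power_add)
      qed
      finally show ?thesis by simp
    qed
    moreover have "(\<lambda>n. cnj ((\<Sum>z\<in>#Z n. inverse (sgn z) ^ Suc k) / of_nat n)) \<longlonglongrightarrow> cnj 0"
      by (intro tendsto_cnj average_inverse_power)
    ultimately show ?thesis using 3 by simp
  qed
qed

lemma average_Laurent_poly:
  "(\<lambda>n. (\<Sum>z\<in>#Z n. poly P (sgn z) / sgn z ^ N) / of_nat n) \<longlonglongrightarrow> coeff P N"
proof -
  let ?I = "{..max N (degree P)}"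
  have "(\<lambda>n. \<Sum>i\<in>?I. coeff P i * ((\<Sum>z\<in>#Z n. sgn z ^ i / sgn z ^ N) / of_nat n))
      \<longlonglongrightarrow> (\<Sum>i\<in>?I. coeff P i * (if i = N then 1 else 0))"
    by (intro tendsto_intros average_monomial)
  moreover have "(\<Sum>i\<in>?I. coeff P i * ((\<Sum>z\<in>#A. sgn z ^ i / sgn z ^ N) / of_nat n))
      = (\<Sum>z\<in>#A. poly P (sgn z) / sgn z ^ N) / of_nat n" for n :: nat and A
  proof (induction A)
    case (add z A)
    have "poly P (sgn z) / sgn z ^ N = (\<Sum>i\<in>?I. coeff P i * (sgn z ^ i / sgn z ^ N))"
      by (simp add: poly_eq_sum_le[of P "max N (degree P)"] sum_divide_distrib)
    then show ?case
      unfolding image_mset_add_mset sum_mset.add_mset add_divide_distrib ring_distribs sum.distrib add.IH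
      by (simp add: sum_divide_distrib)
  qed simp
  ultimately show ?thesis
    by (simp add: if_distrib cong: if_cong)
qed

text \<open>Weyl's criterion by Stone-Weierstrass: for an approximating polynomial q, both the limit
  of the averages and the mean over the circle are \<open>Re (coeff P N)\<close>. Three errors of at
  most \<open>\<epsilon> / 4\<close> remain.\<close>

lemma average_circle:
  fixes f :: "complex \<Rightarrow> real"
  assumes f: "continuous_on (sphere 0 1) f"
  shows "(\<lambda>n. (\<Sum>z\<in>#Z n. f (sgn z)) / real n) \<longlonglongrightarrow> integral {0..2 * pi} (\<lambda>t. f (cis t)) / (2 * pi)"
proof (rule LIMSEQ_I)
  fix \<epsilon> :: real assume \<epsilon>: "\<epsilon> > 0"
  obtain q where q: "real_polynomial_function q"
    and fq: "\<And>z. norm z = 1 \<Longrightarrow> \<bar>f z - q z\<bar> < \<epsilon> / 4"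
    using Stone_Weierstrass_real_polynomial_function[of "sphere 0 1" f "\<epsilon> / 4"] f \<epsilon> by auto
  obtain P N where PN: "\<And>z. norm z = 1 \<Longrightarrow> of_real (q z) = poly P z / z ^ N"
    using real_polynomial_function_circle[OF q] by blast
  have "((\<lambda>t. complex_of_real (q (cis t))) has_integral of_real (2 * pi) * coeff P N) {0..2 * pi}"
    using has_integral_cis_Laurent_poly[of P N] by (simp add: PN)
  from has_integral_Re[OF this]
  have q_int: "((\<lambda>t. q (cis t)) has_integral 2 * pi * Re (coeff P N)) {0..2 * pi}"
    by simp
  have sum_q: "of_real (\<Sum>z\<in>#Z n. q (sgn z)) = (\<Sum>z\<in>#Z n. poly P (sgn z) / sgn z ^ N)" for n
  proof -
    have "of_real (\<Sum>z\<in>#Z n. q (sgn z)) = (\<Sum>z\<in>#Z n. complex_of_real (q (sgn z)))"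
      by (rule of_real_sum_mset)
    also have "\<dots> = (\<Sum>z\<in>#Z n. poly P (sgn z) / sgn z ^ N)"
      using Z_nonzero by (intro arg_cong[where f = sum_mset] image_mset_cong PN) (auto simp: norm_sgn)
    finally show ?thesis .
  qed
  have "(\<lambda>n. Re ((\<Sum>z\<in>#Z n. poly P (sgn z) / sgn z ^ N) / of_nat n)) \<longlonglongrightarrow> Re (coeff P N)"
    by (intro tendsto_Re average_Laurent_poly)
  then have q_lim: "(\<lambda>n. (\<Sum>z\<in>#Z n. q (sgn z)) / real n) \<longlonglongrightarrow> Re (coeff P N)"
    by (simp add: sum_q[symmetric] Re_divide_of_nat)
  define I where "I = integral {0..2 * pi} (\<lambda>t. f (cis t))"
  have "continuous_on {0..2 * pi} (\<lambda>t. f (cis t))"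
    by (rule continuous_on_compose2[OF f]) (auto intro!: continuous_intros)
  then have f_int: "((\<lambda>t. f (cis t)) has_integral I) {0..2 * pi}"
    unfolding I_def by (intro integrable_integral integrable_continuous_real)
  have "norm (I - 2 * pi * Re (coeff P N)) \<le> \<epsilon> / 4 * measure lborel {0..2 * pi}"
    by (rule has_integral_bound_real[OF _ finite.emptyI has_integral_diff[OF f_int q_int]])
       (use \<epsilon> fq in \<open>auto intro: less_imp_le\<close>)
  then have "\<bar>I - 2 * pi * Re (coeff P N)\<bar> \<le> \<epsilon> / 4 * (2 * pi)"
    by simp
  moreover have "I / (2 * pi) - Re (coeff P N) = (I - 2 * pi * Re (coeff P N)) / (2 * pi)"
    by (simp add: field_simps)
  ultimately have lim_close: "\<bar>I / (2 * pi) - Re (coeff P N)\<bar> \<le> \<epsilon> / 4"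
    by (simp add: abs_divide divide_le_eq mult.commute)
  have sum_close: "\<bar>(\<Sum>z\<in>#Z n. f (sgn z)) / real n - (\<Sum>z\<in>#Z n. q (sgn z)) / real n\<bar> \<le> \<epsilon> / 4"
    if "n > 0" for n
  proof -
    \<comment> \<open>Both exceptional sets of \<open>norm_sum_mset_le\<close> are empty
      here.\<close>
    have "norm (\<Sum>z\<in>#Z n. f (sgn z) - q (sgn z)) \<le> \<epsilon> / 4 * real (size (Z n)) + 0 * real (size {#z \<in># Z n. False#})
        + 0 * real (size {#z \<in># Z n. False#})"
      using Z_nonzero fq by (intro norm_sum_mset_le) (auto simp: norm_sgn intro: less_imp_le)
    also have "\<dots> \<le> \<epsilon> / 4 * n"
      using size_Z_le[of n] \<epsilon> by simp
    finally show ?thesis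
      using that by (simp add: sum_mset_diff abs_divide divide_le_eq flip: diff_divide_distrib)
  qed
  have "\<forall>\<^sub>F n in sequentially. \<bar>(\<Sum>z\<in>#Z n. q (sgn z)) / real n - Re (coeff P N)\<bar> < \<epsilon> / 4"
    using tendstoD[OF q_lim, of "\<epsilon> / 4"] \<epsilon> by (simp add: dist_real_def)
  then have "\<forall>\<^sub>F n in sequentially. norm ((\<Sum>z\<in>#Z n. f (sgn z)) / real n - I / (2 * pi)) < \<epsilon>"
    using eventually_gt_at_top[of 0]
  proof eventually_elim
    case (elim n)
    show ?case
      using elim(1) sum_close[OF elim(2)] lim_close \<epsilon> unfolding real_norm_def by linarith
  qed
  then show "\<exists>no. \<forall>n\<ge>no. norm ((\<Sum>z\<in>#Z n. f (sgn z)) / real n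
      - integral {0..2 * pi} (\<lambda>t. f (cis t)) / (2 * pi)) < \<epsilon>"
    by (simp add: eventually_sequentially I_def)
qed

lemma average_roots:
  fixes f :: "complex \<Rightarrow> real"
  assumes f: "continuous_on UNIV f" "bounded (range f)"
  shows "(\<lambda>n. (\<Sum>z\<in>#Z n. f z) / real n) \<longlonglongrightarrow> integral {0..2 * pi} (\<lambda>t. f (cis t)) / (2 * pi)"
proof -
  have "(\<lambda>n. (\<Sum>z\<in>#Z n. complex_of_real (f z) - complex_of_real (f (sgn z))) / of_nat n) \<longlonglongrightarrow> 0"
  proof (rule radial_projection_average)
    show "continuous_on (- {0}) (\<lambda>z. complex_of_real (f z))"
      by (intro continuous_intros continuous_on_subset[OF f(1)]) auto
    show "\<exists>B. \<forall>z. norm z \<ge> c \<longrightarrow> norm (complex_of_real (f z)) \<le> B" for c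
      using f(2) by (auto simp: bounded_iff)
  qed
  from tendsto_Re[OF this]
  have "(\<lambda>n. Re (\<Sum>z\<in>#Z n. complex_of_real (f z) - complex_of_real (f (sgn z))) / real n) \<longlonglongrightarrow> 0"
    by (simp add: Re_divide_of_nat)
  moreover have "Re (\<Sum>z\<in>#A. complex_of_real (f z) - complex_of_real (f (sgn z)))
      = (\<Sum>z\<in>#A. f z) - (\<Sum>z\<in>#A. f (sgn z))" for A
    by (induction A) auto
  ultimately have "(\<lambda>n. (\<Sum>z\<in>#Z n. f z) / real n - (\<Sum>z\<in>#Z n. f (sgn z)) / real n) \<longlonglongrightarrow> 0"
    by (simp add: diff_divide_distrib)
  from tendsto_add[OF this average_circle[OF continuous_on_subset[OF f(1)]]] show ?thesis
    by simp
qed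

end

section \<open>Vanishing low order coefficients\<close>

text \<open>Dividing by \<open>z ^ r\<close>, with r the first index of a nonzero coefficient,
  reduces to a nonzero constant term. The r zeros at 0 have weight r/n.\<close>

lemma (in coefficient_sequence) average_roots_general:
  fixes f :: "complex \<Rightarrow> real"
  assumes f: "continuous_on UNIV f" "bounded (range f)"
  shows "(\<lambda>n. (\<Sum>z\<in>#proots (coeff_poly a n). f z) / real n)
    \<longlonglongrightarrow> integral {0..2 * pi} (\<lambda>t. f (cis t)) / (2 * pi)"
proof -
  have "\<exists>r. a r \<noteq> 0"
  proof -
    obtain n m where "\<delta> \<le> norm (a m)"
      using eventually_happens[OF large_coeff[of 1]] by auto
    then show ?thesis using delta_pos by (intro exI[of _ m]) auto
  qed
  define r where "r = (LEAST r. a r \<noteq> 0)"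
  have r: "a r \<noteq> 0" "\<And>k. k < r \<Longrightarrow> a k = 0"
    unfolding r_def by (rule LeastI_ex[OF \<open>\<exists>r. a r \<noteq> 0\<close>]) (use not_less_Least in blast)
  define b where "b k = a (k + r)" for k
  interpret b: coefficient_sequence_nz b \<delta>
  proof
    show "b 0 \<noteq> 0" using r by (simp add: b_def)
    show "\<delta> > 0" by (rule delta_pos)
  next
    fix \<epsilon> :: real assume "\<epsilon> > 0"
    then obtain C where C: "\<And>k. norm (a k) \<le> C * exp (\<epsilon> * real k)"
      using growth by blast
    have "norm (b k) \<le> (C * exp (\<epsilon> * real r)) * exp (\<epsilon> * real k)" for k
      using C[of "k + r"] by (simp add: b_def distrib_left exp_add ac_simps)
    then show "\<exists>C. \<forall>k. norm (b k) \<le> C * exp (\<epsilon> * real k)" by blast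
  next
    \<comment> \<open>The shift turns n into \<open>n + r\<close>; halving \<epsilon> pays for this.
      The large coefficient has index \<open>m \<ge> r\<close> since it is nonzero, so
      \<open>m - r\<close> serves for b.\<close>
    fix \<epsilon> :: real assume \<epsilon>: "\<epsilon> > 0"
    have "\<forall>\<^sub>F n in sequentially. \<exists>m\<le>n + r. real (n + r) - real m \<le> \<epsilon> / 2 * real (n + r) \<and> \<delta> \<le> norm (a m)"
      by (rule eventually_sequentially_seg[THEN iffD2]) (rule large_coeff, use \<epsilon> in simp)
    moreover have "\<forall>\<^sub>F n in sequentially. \<epsilon> / 2 * (real n + real r) \<le> \<epsilon> * real n"
      using \<epsilon> by real_asymp
    ultimately show "\<forall>\<^sub>F n in sequentially. \<exists>m\<le>n. real n - real m \<le> \<epsilon> * real n \<and> \<delta> \<le> norm (b m)"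
    proof eventually_elim
      case (elim n)
      then obtain m where m: "m \<le> n + r" "real (n + r) - real m \<le> \<epsilon> / 2 * real (n + r)" "\<delta> \<le> norm (a m)"
        by blast
      have "r \<le> m"
        using r(2)[of m] m(3) delta_pos by (cases "r \<le> m") auto
      then show ?case
        using m elim(2) by (intro exI[of _ "m - r"]) (auto simp: b_def of_nat_diff)
    qed
  qed
  have Z: "proots (coeff_poly a (n + r)) = replicate_mset r 0 + b.Z n" for n
  proof -
    have "coeff_poly a (n + r) = monom 1 r * coeff_poly b n"
      using r(2) by (auto simp: poly_eq_iff coeff_coeff_poly b_def coeff_monom_mult)
    then have "proots (coeff_poly a (n + r)) = proots (monom 1 r) + proots (coeff_poly b n)"
      using b.G_nonzero by (simp add: proots_mult)
    also have "proots (monom 1 r :: complex poly) = replicate_mset r 0"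
      by (simp add: monom_altdef proots_power)
    finally show ?thesis .
  qed
  have "(\<lambda>n. real r * f 0 / real (n + r)) \<longlonglongrightarrow> 0" "(\<lambda>n. real n / real (n + r)) \<longlonglongrightarrow> 1"
    by real_asymp+
  from tendsto_add[OF this(1) tendsto_mult[OF b.average_roots[OF f] this(2)]]
  have "(\<lambda>n. real r * f 0 / real (n + r) + (\<Sum>z\<in>#b.Z n. f z) / real n * (real n / real (n + r)))
    \<longlonglongrightarrow> integral {0..2 * pi} (\<lambda>t. f (cis t)) / (2 * pi)"
    by simp
  then have "(\<lambda>n. (\<Sum>z\<in>#proots (coeff_poly a (n + r)). f z) / real (n + r))
     \<longlonglongrightarrow> integral {0..2 * pi} (\<lambda>t. f (cis t)) / (2 * pi)"
  proof (rule Lim_transform_eventually)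
    show "\<forall>\<^sub>F n in sequentially. real r * f 0 / real (n + r)
        + (\<Sum>z\<in>#b.Z n. f z) / real n * (real n / real (n + r))
        = (\<Sum>z\<in>#proots (coeff_poly a (n + r)). f z) / real (n + r)"
      using eventually_gt_at_top[of 0] by eventually_elim (simp add: Z add_divide_distrib)
  qed
  then show ?thesis
    by (rule LIMSEQ_offset)
qed

section \<open>Integrals against the empirical and the uniform measure\<close>

lemma sum_mset_eq_sum_count:
  fixes f :: "'a \<Rightarrow> real"
  assumes "finite S" "set_mset A \<subseteq> S"
  shows "(\<Sum>z\<in>#A. f z) = (\<Sum>z\<in>S. real (count A z) * f z)"
  using assms(2)
proof (induction A)
  case (add x A)
  have "(\<Sum>z\<in>S. real (count (add_mset x A) z) * f z)
      = (\<Sum>z\<in>S. real (count A z) * f z + (if x = z then f z else 0))"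
    by (intro sum.cong) (auto simp: algebra_simps)
  also have "\<dots> = (\<Sum>z\<in>#A. f z) + f x"
    using add assms(1) by (simp add: sum.distrib)
  finally show ?case by simp
qed simp

text \<open>Integrals over a finite point measure are sums; pushing forward along the identity only
  changes the sigma-algebra to the Borel sets. For \<open>n = 0\<close> both sides vanish, as
  division by 0 gives 0.\<close>

lemma empirical_zero_measure_eq_distr:
  "empirical_zero_measure n p =
    distr (point_measure (set_mset (proots p)) (\<lambda>z. real (count (proots p) z) / real n)) borel (\<lambda>z. z)"
    (is "_ = distr ?P _ _")
proof (rule measure_eqI)
  fix A assume "A \<in> sets (empirical_zero_measure n p)"
  then have A: "A \<in> sets borel" by simp
  let ?Z = "proots p"
  have "real (zero_count p A) = (\<Sum>z\<in>A \<inter> set_mset ?Z. real (count ?Z z))"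
  proof -
    have "zero_count p A = (\<Sum>z\<in>{z \<in> set_mset ?Z. z \<in> A}. count ?Z z)"
      unfolding zero_count_def size_multiset_overloaded_eq by (intro sum.cong) auto
    also have "{z \<in> set_mset ?Z. z \<in> A} = A \<inter> set_mset ?Z" by auto
    finally show ?thesis by simp
  qed
  then have "emeasure (empirical_zero_measure n p) A
      = ennreal (\<Sum>z\<in>A \<inter> set_mset ?Z. real (count ?Z z) / real n)"
    using A by (simp add: empirical_zero_measure_def emeasure_zero_measure ennreal_of_nat_eq_real_of_nat
        ennreal_mult[symmetric] sum_divide_distrib[symmetric])
  also have "\<dots> = emeasure ?P (A \<inter> set_mset ?Z)"
    by (subst emeasure_point_measure_finite2) (auto simp: sum_ennreal)
  also have "\<dots> = emeasure (distr ?P borel (\<lambda>z. z)) A"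
    using A by (subst emeasure_distr) (auto simp: space_point_measure)
  finally show "emeasure (empirical_zero_measure n p) A = emeasure (distr ?P borel (\<lambda>z. z)) A" .
qed simp

lemma integral_empirical_zero_measure:
  fixes f :: "complex \<Rightarrow> real"
  assumes "f \<in> borel_measurable borel"
  shows "integral\<^sup>L (empirical_zero_measure n p) f = (\<Sum>z\<in>#proots p. f z) / real n"
proof -
  have "integral\<^sup>L (empirical_zero_measure n p) f
      = (\<Sum>z\<in>set_mset (proots p). real (count (proots p) z) / real n * f z)"
    unfolding empirical_zero_measure_eq_distr using assms
    by (subst integral_distr) (auto simp: lebesgue_integral_point_measure_finite)
  also have "\<dots> = (\<Sum>z\<in>#proots p. f z) / real n"
    by (simp add: sum_mset_eq_sum_count[of "set_mset (proots p)"] sum_divide_distrib)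
  finally show ?thesis .
qed

text \<open>Normalising before the push-forward gives a density on the line, so that integrals can
  be computed there.\<close>

lemma uniform_circle_eq_distr_uniform_measure:
  "uniform_circle = distr (uniform_measure lborel {0..<2 * pi}) borel cis"
proof (rule measure_eqI)
  fix A assume "A \<in> sets uniform_circle"
  then have A: "A \<in> sets borel" by simp
  have "{0..<2 * pi} \<inter> cis -` A = {t \<in> {0..<2 * pi}. cis t \<in> A}" by auto
  moreover have "cis -` A \<in> sets borel"
    using measurable_sets[OF borel_measurable_cis A] by simp
  ultimately show "emeasure uniform_circle A
      = emeasure (distr (uniform_measure lborel {0..<2 * pi}) borel cis) A"
    using A by (simp add: emeasure_uniform_circle emeasure_circle_arc_length emeasure_distr)
qed simp

lemma integral_uniform_circle:
  fixes f :: "complex \<Rightarrow> real"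
  assumes "continuous_on UNIV f"
  shows "integral\<^sup>L uniform_circle f = integral {0..2 * pi} (\<lambda>t. f (cis t)) / (2 * pi)"
proof -
  have f [measurable]: "f \<in> borel_measurable borel"
    using assms by (rule borel_measurable_continuous_onI)
  have cont: "continuous_on {0..2 * pi} (\<lambda>t. f (cis t))"
    by (intro continuous_on_compose2[OF assms] continuous_intros) auto
  have density: "uniform_measure lborel {0..<2 * pi}
      = density lborel (\<lambda>t. ennreal (indicator {0..<2 * pi} t / (2 * pi)))"
    unfolding uniform_measure_def
    using divide_ennreal[of 1 "2 * pi"] by (intro density_cong) (auto simp: indicator_def)
  have "integral\<^sup>L uniform_circle f
      = (LINT t|lborel. (indicator {0..<2 * pi} t / (2 * pi)) *\<^sub>R f (cis t))"
    unfolding uniform_circle_eq_distr_uniform_measure density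
    by (subst integral_distr) (auto simp: integral_density)
  also have "\<dots> = (LINT t|lborel. indicator {0..2 * pi} t *\<^sub>R f (cis t) / (2 * pi))"
  proof (rule integral_cong_AE)
    show "AE t in lborel. (indicator {0..<2 * pi} t / (2 * pi)) *\<^sub>R f (cis t)
        = indicator {0..2 * pi} t *\<^sub>R f (cis t) / (2 * pi)"
      using AE_lborel_singleton[of "2 * pi"] by eventually_elim (auto simp: indicator_def)
  qed auto
  also have "\<dots> = (LINT t:{0..2 * pi}|lborel. f (cis t)) / (2 * pi)"
    by (simp add: set_lebesgue_integral_def)
  also have "(LINT t:{0..2 * pi}|lborel. f (cis t)) = integral {0..2 * pi} (\<lambda>t. f (cis t))"
    by (rule set_borel_integral_eq_integral(2)[OF borel_integrable_atLeastAtMost'[OF cont]])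
  finally show ?thesis .
qed

lemma (in coefficient_sequence) weakly_converges_empirical_zero_measure:
  "weakly_converges (\<lambda>n. empirical_zero_measure n (coeff_poly a n)) uniform_circle"
  unfolding weakly_converges_def
proof (intro conjI allI impI)
  show "finite_measure uniform_circle"
    using prob_space_uniform_circle by (rule prob_space.finite_measure)
next
  fix f :: "complex \<Rightarrow> real"
  assume f: "continuous_on UNIV f" "bounded (range f)"
  then have "f \<in> borel_measurable borel"
    by (intro borel_measurable_continuous_onI)
  then show "(\<lambda>n. integral\<^sup>L (empirical_zero_measure n (coeff_poly a n)) f)
      \<longlonglongrightarrow> integral\<^sup>L uniform_circle f"
    using average_roots_general[OF f] f
    by (simp add: integral_empirical_zero_measure integral_uniform_circle)
qed (auto simp: finite_measure_empirical_zero_measure)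

section \<open>Almost sure behaviour of independent identically distributed coefficients\<close>

text \<open>Pointwise, at most \<open>X \<omega> / \<epsilon> + 1\<close> indices k satisfy
  \<open>\<epsilon> * real k < X \<omega>\<close>; taking expectations bounds all partial
  sums.\<close>

lemma (in prob_space) summable_tail_prob:
  fixes X :: "'a \<Rightarrow> real"
  assumes X: "integrable M X" "\<And>\<omega>. X \<omega> \<ge> 0" and \<epsilon>: "\<epsilon> > 0"
  shows "summable (\<lambda>k. \<P>(\<omega> in M. X \<omega> > \<epsilon> * real k))"
proof (rule summableI_nonneg_bounded)
  fix n
  have [measurable]: "X \<in> borel_measurable M" using X by auto
  let ?A = "\<lambda>k. {\<omega> \<in> space M. X \<omega> > \<epsilon> * real k}"
  have "(\<Sum>k<n. prob (?A k)) = (\<Sum>k<n. expectation (indicator (?A k)))"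
    by simp
  also have "\<dots> = expectation (\<lambda>\<omega>. \<Sum>k<n. indicator (?A k) \<omega>)"
    by (subst Bochner_Integration.integral_sum) (auto simp: less_top[symmetric])
  also have "\<dots> \<le> expectation (\<lambda>\<omega>. X \<omega> / \<epsilon> + 1)"
  proof (rule integral_mono)
    fix \<omega> assume "\<omega> \<in> space M"
    then have "(\<Sum>k<n. indicator (?A k) \<omega>) = (\<Sum>k<n. if X \<omega> > \<epsilon> * real k then 1 else 0 :: real)"
      by (intro sum.cong) auto
    also have "\<dots> = real (card {k. k < n \<and> X \<omega> > \<epsilon> * real k})"
      by (simp add: sum.If_cases Int_def)
    also have "card {k. k < n \<and> X \<omega> > \<epsilon> * real k} \<le> card {..<nat \<lceil>X \<omega> / \<epsilon>\<rceil>}"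
      using \<epsilon> by (intro card_mono) (auto simp: field_simps zless_nat_eq_int_zless less_ceiling_iff)
    also have "real (card {..<nat \<lceil>X \<omega> / \<epsilon>\<rceil>}) \<le> X \<omega> / \<epsilon> + 1"
      using of_int_ceiling_le_add_one[of "X \<omega> / \<epsilon>"] X(2)[of \<omega>] \<epsilon> by simp
    finally show "(\<Sum>k<n. indicator (?A k) \<omega>) \<le> X \<omega> / \<epsilon> + 1"
      by simp
  qed (use X in \<open>auto simp: less_top[symmetric]\<close>)
  finally show "(\<Sum>k<n. prob (?A k)) \<le> expectation (\<lambda>\<omega>. X \<omega> / \<epsilon> + 1)" .
qed simp

locale iid_coefficients = prob_space +
  fixes \<xi> :: "nat \<Rightarrow> 'a \<Rightarrow> complex"
  assumes indep: "indep_vars (\<lambda>_. borel) \<xi> UNIV"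
    and ident: "\<And>k. distr M borel (\<xi> k) = distr M borel (\<xi> 0)"
begin

lemma measurable_xi [measurable]: "\<xi> k \<in> borel_measurable M"
  using indep unfolding indep_vars_def by auto

lemma prob_xi:
  assumes "Measurable.pred borel P"
  shows "\<P>(\<omega> in M. P (\<xi> k \<omega>)) = \<P>(\<omega> in M. P (\<xi> 0 \<omega>))"
proof -
  have "\<P>(\<omega> in M. P (\<xi> j \<omega>)) = measure (distr M borel (\<xi> j)) {z. P z}" for j
    using assms by (subst measure_distr) (auto intro!: arg_cong[where f = prob])
  then show ?thesis
    using ident[of k] by simp
qed

lemma AE_subexponential:
  assumes int: "integrable M (\<lambda>\<omega>. ln (1 + norm (\<xi> 0 \<omega>)))" and \<epsilon>: "\<epsilon> > 0"
  shows "AE \<omega> in M. \<exists>C. \<forall>k. norm (\<xi> k \<omega>) \<le> C * exp (\<epsilon> * real k)"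
proof -
  let ?A = "\<lambda>k. {\<omega> \<in> space M. ln (1 + norm (\<xi> k \<omega>)) > \<epsilon> * real k}"
  have "summable (\<lambda>k. \<P>(\<omega> in M. ln (1 + norm (\<xi> 0 \<omega>)) > \<epsilon> * real k))"
    by (rule summable_tail_prob[OF int _ \<epsilon>]) simp
  then have "summable (\<lambda>k. prob (?A k))"
    by (subst prob_xi) auto
  then have "AE \<omega> in M. \<forall>\<^sub>F k in sequentially. \<omega> \<in> space M - ?A k"
    by (intro borel_cantelli_AE1) (auto simp: less_top[symmetric])
  then show ?thesis
  proof eventually_elim
    case (elim \<omega>)
    then obtain K where K: "\<And>k. k \<ge> K \<Longrightarrow> ln (1 + norm (\<xi> k \<omega>)) \<le> \<epsilon> * real k"
      unfolding eventually_sequentially by (auto simp: not_less)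
    \<comment> \<open>Covers the finitely many indices before K; the summand 1 covers the
      rest.\<close>
    define C where "C = 1 + (\<Sum>k<K. norm (\<xi> k \<omega>))"
    have C1: "C \<ge> 1" by (simp add: C_def sum_nonneg)
    have "norm (\<xi> k \<omega>) \<le> C * exp (\<epsilon> * real k)" for k
    proof (cases "k < K")
      case True
      then have "norm (\<xi> k \<omega>) \<le> (\<Sum>k<K. norm (\<xi> k \<omega>))"
        by (intro member_le_sum) auto
      then have "norm (\<xi> k \<omega>) \<le> C * 1" by (simp add: C_def)
      also have "\<dots> \<le> C * exp (\<epsilon> * real k)"
        using C1 \<epsilon> by (intro mult_left_mono) auto
      finally show ?thesis .
    next
      case False
      have "1 + norm (\<xi> k \<omega>) = exp (ln (1 + norm (\<xi> k \<omega>)))"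
        by (simp add: add_pos_nonneg)
      also have "\<dots> \<le> exp (\<epsilon> * real k)"
        using K[of k] False by simp
      also have "\<dots> \<le> C * exp (\<epsilon> * real k)"
        using C1 by simp
      finally show ?thesis by simp
    qed
    then show ?case by blast
  qed
qed

text \<open>Otherwise \<open>norm (\<xi> 0 \<omega>)\<close> would almost surely lie below every
  \<open>inverse (real (Suc j))\<close>, hence be 0.\<close>

lemma exists_threshold:
  assumes "\<P>(\<omega> in M. \<xi> 0 \<omega> = 0) < 1"
  shows "\<exists>\<delta>>0. \<P>(\<omega> in M. norm (\<xi> 0 \<omega>) < \<delta>) < 1"
proof (rule ccontr)
  assume "\<not> ?thesis"
  then have "\<P>(\<omega> in M. norm (\<xi> 0 \<omega>) < inverse (real (Suc j))) = 1" for j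
    using prob_le_1 by (metis inverse_positive_iff_positive of_nat_0_less_iff order_antisym_conv not_less zero_less_Suc)
  then have "AE \<omega> in M. norm (\<xi> 0 \<omega>) < inverse (real (Suc j))" for j
    by (subst (asm) prob_Collect_eq_1) auto
  then have "AE \<omega> in M. \<forall>j. norm (\<xi> 0 \<omega>) < inverse (real (Suc j))"
    by (simp add: AE_all_countable)
  then have "AE \<omega> in M. \<xi> 0 \<omega> = 0"
  proof eventually_elim
    case (elim \<omega>)
    show ?case
    proof (rule ccontr)
      assume "\<xi> 0 \<omega> \<noteq> 0"
      then obtain j where "inverse (real (Suc j)) < norm (\<xi> 0 \<omega>)"
        using reals_Archimedean[of "norm (\<xi> 0 \<omega>)"] by auto
      then show False using elim by (meson less_asym)
    qed
  qed
  then have "\<P>(\<omega> in M. \<xi> 0 \<omega> = 0) = 1"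
    by (subst prob_Collect_eq_1) auto
  then show False using assms by simp
qed

text \<open>The window holds a fixed proportion of the indices up to n, so by independence all its
  entries are small with a probability that decays geometrically in n.\<close>

lemma AE_large_coefficient:
  assumes \<delta>: "\<P>(\<omega> in M. norm (\<xi> 0 \<omega>) < \<delta>) < 1"
  shows "AE \<omega> in M. \<forall>\<^sub>F n in sequentially. \<exists>m\<in>{n - n div Suc j..n}. \<delta> \<le> norm (\<xi> m \<omega>)"
proof -
  define J where "J n = {n - n div Suc j..n}" for n
  \<comment> \<open>The 1/2 keeps q positive for \<open>powr\<close> even if the probability is
    0.\<close>
  define q where "q = max (1 / 2) \<P>(\<omega> in M. norm (\<xi> 0 \<omega>) < \<delta>)"
  have q: "0 < q" "q < 1" using \<delta> by (auto simp: q_def)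
  have cardJ: "card (J n) = Suc (n div Suc j)" for n
    by (simp add: J_def Suc_diff_le)
  let ?A = "\<lambda>n. {\<omega> \<in> space M. \<forall>m\<in>J n. norm (\<xi> m \<omega>) < \<delta>}"
  have A_meas: "?A n \<in> sets M" for n
    unfolding J_def by measurable
  have prob_A: "prob (?A n) \<le> (q powr (1 / Suc j)) ^ n" for n
  proof -
    have "?A n = (\<Inter>m\<in>J n. \<xi> m -` {z. norm z < \<delta>} \<inter> space M)"
      by (auto simp: J_def)
    then have "prob (?A n) = (\<Prod>m\<in>J n. prob (\<xi> m -` {z. norm z < \<delta>} \<inter> space M))"
      using indep_varsD[OF indep, of "J n" "\<lambda>_. {z. norm z < \<delta>}"] by (simp add: J_def)
    also have "\<dots> = (\<Prod>m\<in>J n. \<P>(\<omega> in M. norm (\<xi> 0 \<omega>) < \<delta>))"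
    proof (rule prod.cong)
      fix m
      have "\<xi> m -` {z. norm z < \<delta>} \<inter> space M = {\<omega> \<in> space M. norm (\<xi> m \<omega>) < \<delta>}"
        by auto
      then show "prob (\<xi> m -` {z. norm z < \<delta>} \<inter> space M) = \<P>(\<omega> in M. norm (\<xi> 0 \<omega>) < \<delta>)"
        using prob_xi[of "\<lambda>z. norm z < \<delta>" m] by simp
    qed simp
    also have "\<dots> = \<P>(\<omega> in M. norm (\<xi> 0 \<omega>) < \<delta>) ^ Suc (n div Suc j)"
      by (simp add: cardJ)
    also have "\<dots> \<le> q ^ Suc (n div Suc j)"
      by (intro power_mono) (auto simp: q_def)
    also have "\<dots> = q powr real (Suc (n div Suc j))"
      using q by (subst powr_realpow) auto
    \<comment> \<open>The window has \<open>Suc (n div Suc j)\<close> elements; the extra one makes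
      up for rounding down.\<close>
    also have "\<dots> \<le> q powr (real n / real (Suc j))"
    proof (rule powr_mono')
      have "n \<le> Suc j * Suc (n div Suc j)"
        using mult_div_mod_eq[of "Suc j" n] mod_less_divisor[of "Suc j" n]
        by (metis add_le_cancel_left less_imp_le mult_Suc_right zero_less_Suc add.commute)
      then have "real n \<le> real (Suc j) * real (Suc (n div Suc j))"
        by (simp only: of_nat_mult[symmetric] of_nat_le_iff)
      then show "real n / real (Suc j) \<le> real (Suc (n div Suc j))"
        by (simp add: divide_le_eq mult.commute del: of_nat_Suc)
    qed (use q in auto)
    also have "\<dots> = (q powr (1 / Suc j)) ^ n"
      using q by (simp add: powr_powr powr_realpow[symmetric])
    finally show ?thesis .
  qed
  have "summable (\<lambda>n. prob (?A n))"
  proof (rule summable_comparison_test')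
    show "summable (\<lambda>n. (q powr (1 / Suc j)) ^ n)"
      using q powr_less_mono2[of "1 / Suc j" q 1] by (intro summable_geometric) simp
  qed (use prob_A in auto)
  then have "AE \<omega> in M. \<forall>\<^sub>F n in sequentially. \<omega> \<in> space M - ?A n"
    using A_meas by (intro borel_cantelli_AE1) (auto simp: less_top[symmetric])
  then show ?thesis
    by eventually_elim (auto elim!: eventually_mono simp: J_def not_less)
qed

text \<open>The values \<open>inverse (real (Suc j))\<close> suffice for \<epsilon>, and being
  countably many they allow one exceptional null set for all \<epsilon>.\<close>

lemma AE_coefficient_sequence:
  assumes "integrable M (\<lambda>\<omega>. ln (1 + norm (\<xi> 0 \<omega>)))"
    and "\<delta> > 0" "\<P>(\<omega> in M. norm (\<xi> 0 \<omega>) < \<delta>) < 1"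
  shows "AE \<omega> in M. coefficient_sequence (\<lambda>k. \<xi> k \<omega>) \<delta>"
proof -
  have "AE \<omega> in M. \<forall>j. \<exists>C. \<forall>k. norm (\<xi> k \<omega>) \<le> C * exp (inverse (real (Suc j)) * real k)"
    using AE_subexponential[OF assms(1)] by (simp add: AE_all_countable)
  moreover have "AE \<omega> in M. \<forall>j. \<forall>\<^sub>F n in sequentially.
      \<exists>m\<in>{n - n div Suc j..n}. \<delta> \<le> norm (\<xi> m \<omega>)"
    using AE_large_coefficient[OF assms(3)] by (simp add: AE_all_countable)
  ultimately show ?thesis
  proof eventually_elim
    case (elim \<omega>)
    show ?case
    proof
      fix \<epsilon> :: real assume "\<epsilon> > 0"
      then obtain j where j: "inverse (real (Suc j)) < \<epsilon>"
        using reals_Archimedean by blast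
      obtain C where C: "\<And>k. norm (\<xi> k \<omega>) \<le> C * exp (inverse (real (Suc j)) * real k)"
        using elim(1) by blast
      have "C \<ge> 0" using order_trans[OF norm_ge_zero C[of 0]] by simp
      have "norm (\<xi> k \<omega>) \<le> C * exp (\<epsilon> * real k)" for k
        by (rule order_trans[OF C])
           (use j \<open>C \<ge> 0\<close> in \<open>auto intro!: mult_left_mono mult_right_mono simp del: of_nat_Suc\<close>)
      then show "\<exists>C. \<forall>k. norm (\<xi> k \<omega>) \<le> C * exp (\<epsilon> * real k)" by blast
      show "\<forall>\<^sub>F n in sequentially. \<exists>m\<le>n. real n - real m \<le> \<epsilon> * real n \<and> \<delta> \<le> norm (\<xi> m \<omega>)"
        using elim(2)[rule_format, of j]
      proof eventually_elim
        case (elim n)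
        then obtain m where m: "n - n div Suc j \<le> m" "m \<le> n" "\<delta> \<le> norm (\<xi> m \<omega>)"
          by auto
        have "real n - real m \<le> real (n div Suc j)"
          using m by linarith
        also have "\<dots> \<le> real n / real (Suc j)"
          by (rule of_nat_div_le_of_nat)
        also have "\<dots> = inverse (real (Suc j)) * real n"
          by (simp add: divide_inverse mult.commute)
        also have "\<dots> \<le> \<epsilon> * real n"
          using j by (intro mult_right_mono) auto
        finally show ?case using m by blast
      qed
    qed (use assms in auto)
  qed
qed

end

theorem theorem2:
  fixes M :: "'w measure" and \<xi> :: "nat \<Rightarrow> 'w \<Rightarrow> complex"
  assumes "prob_space M"
    and "prob_space.indep_vars M (\<lambda>_. borel) \<xi> UNIV"
    and "\<And>k. distr M borel (\<xi> k) = distr M borel (\<xi> 0)"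
    and "\<P>(\<omega> in M. \<xi> 0 \<omega> = 0) < 1"
    and "integrable M (\<lambda>\<omega>. ln (1 + norm (\<xi> 0 \<omega>)))"
  shows "AE \<omega> in M. weakly_converges
    (\<lambda>n. empirical_zero_measure n (coeff_poly (\<lambda>k. \<xi> k \<omega>) n)) uniform_circle"
proof -
  interpret iid_coefficients M \<xi>
    using assms(1-3) by (simp add: iid_coefficients_def iid_coefficients_axioms_def)
  obtain \<delta> where "\<delta> > 0" "\<P>(\<omega> in M. norm (\<xi> 0 \<omega>) < \<delta>) < 1"
    using exists_threshold[OF assms(4)] by blast
  from AE_coefficient_sequence[OF assms(5) this] show ?thesis
    by eventually_elim (rule coefficient_sequence.weakly_converges_empirical_zero_measure)
qed

end
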